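(* Let $F=f+r$ on $\mathbb{R}^d$ with stochastic models $f_x(\cdot;\xi)$ of $f$ and a function $\omega$ satisfying the standing conditions of the context (measurability, one-sided accuracy with constant $\tau>0$, relative weak convexity with constant $\rho>0$, relative Lipschitz continuity with growth function $L(\cdot)$, and $F^*:=\inf F>-\infty$). Let $K\ge1$, let $\lambda\in\big(0,\frac1{\tau+\rho}\big)$, and let $\{t_k\}_{k\ge0}$ be a nonincreasing step size sequence with $0<t_k<\min\{\frac1\rho,\frac1\tau\}$. Let $x^0\in\operatorname{dom}r$, and let $\{x^k\}$ and $x^{\bar k}$ be generated by: for $k=0,\dots,K-1$ sample $\xi_k\sim P$ (independently) and set $$x^{k+1}=\operatorname*{arg\,min}_{y\in\mathbb{R}^d}\Big\{f_{x^k}(y;\xi_k)+r(y)+\frac1{t_k}D_\omega(y,x^k)\Big\};$$ then sample $\bar k\in\{0,\dots,K-1\}$ with $\mathbb{P}(\bar k=k)=t_k/\sum_{i=0}^{K-1}t_i$. Write $\hat x^{k}:=\operatorname{prox}^\omega_{\lambda F}(x^{k})$. (a) If there is $L_f>0$ with $L(x)\le L_f$ for all $x\in\mathbb{R}^d$, then $$\mathbb{E}\big[D^{\mathrm{sym}}_{\omega,\lambda}(\hat x^{\bar k},x^{\bar k})\big]\le\frac{F^\omega_\lambda(x^0)-F^*+\frac{t_0}{\lambda(1-t_0\rho)}\big(F(x^0)-F^*\big)+\frac{L_f^2}{\lambda}\sum_{k=0}^{K-1}\frac{t_k^2}{(1-t_k\rho)(1-t_k\tau)}}{(1-\lambda(\tau+\rho))\sum_{k=0}^{K-1}t_k}.$$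 In particular, if $\lambda=\frac1{2(\tau+\rho)}$ and $t_k=\frac c{\sqrt K}$ with $0<c\le\min\{\frac1{2\rho},\frac1{2\tau}\}$, then for any $\delta\ge\max\{F^\omega_\lambda(x^0)-F^*,F(x^0)-F^*\}$, $$\mathbb{E}\big[D^{\mathrm{sym}}_{\omega,1/(2(\tau+\rho))}(\hat x^{\bar k},x^{\bar k})\big]\le\frac2{c\sqrt K}\Big(\delta+\frac{4(\tau+\rho)c\delta}{\sqrt K}+8(\tau+\rho)L_f^2c^2\Big).$$ (b) Suppose there are $\alpha_1,\beta_1>0$ with $L(x)\le\sqrt{\alpha_1(F^\omega_\lambda(x)-F^* )+\beta_1}$ for all $x\in\mathbb{R}^d$, and that $\frac{\alpha_1}\lambda\sum_{k=0}^{K-1}\frac{t_k^2}{(1-t_k\rho)(1-t_k\tau)}<1$. Then $$\mathbb{E}\big[D^{\mathrm{sym}}_{\omega,\lambda}(\hat x^{\bar k},x^{\bar k})\big]\le\frac{F^\omega_\lambda(x^0)-F^*+\frac{t_0}{\lambda(1-t_0\rho)}\big(F(x^0)-F^*\big)+\frac{\beta_1}\lambda\sum_{k=0}^{K-1}\frac{t_k^2}{(1-t_k\rho)(1-t_k\tau)}}{(1-\lambda(\tau+\rho))\Big(1-\frac{\alpha_1}\lambda\sum_{k=0}^{K-1}\frac{t_k^2}{(1-t_k\rho)(1-t_k\tau)}\Big)\sum_{k=0}^{K-1}t_k}.$$ In particular, if $\lambda=\frac1{2(\tau+\rho)}$ and $t_k=\frac c{\sqrt K}$ with $0<c\le\min\{\frac1{2\rho},\frac1{2\tau}\}$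 and $8\alpha_1(\tau+\rho)c^2<1$, then for any $\delta\ge\max\{F^\omega_\lambda(x^0)-F^*,F(x^0)-F^*\}$, $$\mathbb{E}\big[D^{\mathrm{sym}}_{\omega,1/(2(\tau+\rho))}(\hat x^{\bar k},x^{\bar k})\big]\le\frac2{c\sqrt K}\cdot\frac{\delta+\frac{4(\tau+\rho)c\delta}{\sqrt K}+8(\tau+\rho)\beta_1c^2}{1-8\alpha_1(\tau+\rho)c^2}.$$
   Context: Norm and inner product are Euclidean; $\omega$ is $1$-strongly convex if $\omega-\frac12\|\cdot\|^2$ is convex. Bregman distance: $D_\omega(y,x):=\omega(y)-\omega(x)-\langle\nabla\omega(x),y-x\rangle$. A proper lower semicontinuous $\varphi$ is $\rho\omega$-relatively weakly convex if $\varphi+\rho\omega$ is convex. $F^\omega_\lambda(x):=\min_y\{F(y)+\frac1\lambda D_\omega(y,x)\}$; $\operatorname{prox}^\omega_{\lambda F}(x)$ is the corresponding minimizer (single-valued for $\lambda\in(0,1/(\tau+\rho))$, since $F$ is $(\tau+\rho)\omega$-relatively weakly convex). $D^{\mathrm{sym}}_{\omega,\lambda}(u,x):=\frac1{\lambda^2}(D_\omega(u,x)+D_\omega(x,u))$. $\operatorname{dom}r:=\{x:r(x)<\infty\}$. Setting. $(\Omega,\mathcal F,P)$ is a probability space, $f(x):=\mathbb{E}_{\xi\sim P}[f(x;\xi)]$ with $f(\cdot;\xi):\mathbb{R}^d\to\mathbb{R}$ proper lower semicontinuous for almost every $\xi$, $r:\mathbb{R}^d\to\mathbb{R}$ is deterministic,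 and $F:=f+r$. Standing conditions. $r$ is proper and lower semicontinuous; $(x,y,\xi)\mapsto f_x(y;\xi)$ is jointly measurable; $f_x(\cdot;\xi)+r(\cdot)$ is proper and lower semicontinuous for every $x$ and almost every $\xi$; $F^*:=\inf_xF(x)>-\infty$; $\omega:\mathbb{R}^d\to\mathbb{R}$ is continuously differentiable and $1$-strongly convex; and there are constants $\tau,\rho>0$ such that: (1) One-sided accuracy: for all $x,y\in\mathbb{R}^d$, $\mathbb{E}_\xi[f_x(x;\xi)]=f(x)$ and $\mathbb{E}_\xi[f_x(y;\xi)-f(y)]\le\tau\min\{D_\omega(x,y),D_\omega(y,x)\}$. (2) Relative weak convexity: for every $x\in\mathbb{R}^d$ and $\xi\in\Omega$, $f_x(\cdot;\xi)+r(\cdot)$ is $\rho\omega$-relatively weakly convex. (3) Relative Lipschitz continuity: there exist a measurable $\widetilde L:\mathbb{R}^d\times\Omega\to\mathbb{R}_+$ and a function $L:\mathbb{R}^d\to\mathbb{R}_+$ with $\sqrt{\mathbb{E}_\xi[\widetilde L^2(x;\xi)]}\le L(x)$ for every $x$ and, for all $x,y\in\mathbb{R}^d$ and almost every $\xi$, $f_x(x;\xi)-f_x(y;\xi)\le\widetilde L(x;\xi)\sqrt{\min\{D_\omega(x,y),D_\omega(y,x)\}}$. *)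

theory Defs
  imports "HOL-Probability.Probability"
begin

text \<open>
  Functions that may take the value \<open>+\<infinity>\<close> have values in \<open>ereal\<close>; the effective domain of \<open>r\<close>
  is \<open>{x. r x < \<infinity>}\<close>.
\<close>

definition proper :: "('a \<Rightarrow> ereal) \<Rightarrow> bool" where
  "proper \<phi> \<longleftrightarrow> (\<forall>x. \<phi> x \<noteq> -\<infinity>) \<and> (\<exists>x. \<phi> x < \<infinity>)"

definition lsc :: "('a::topological_space \<Rightarrow> ereal) \<Rightarrow> bool" where
  "lsc \<phi> \<longleftrightarrow> (\<forall>a. open {x. a < \<phi> x})"

text \<open>
  The library's \<open>convex_on\<close> is for real-valued functions. Here \<open>0 * \<infinity> = 0\<close>, and the definition
  is only used for functions that never take the value \<open>-\<infinity>\<close>.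
\<close>

definition ereal_convex :: "('a::real_vector \<Rightarrow> ereal) \<Rightarrow> bool" where
  "ereal_convex \<phi> \<longleftrightarrow> (\<forall>x y. \<forall>u\<ge>0. \<forall>v\<ge>0. u + v = 1 \<longrightarrow>
     \<phi> (u *\<^sub>R x + v *\<^sub>R y) \<le> ereal u * \<phi> x + ereal v * \<phi> y)"

definition grad :: "('a::real_inner \<Rightarrow> real) \<Rightarrow> 'a \<Rightarrow> 'a" where
  "grad f x = (THE g. GDERIV f x :> g)"

definition continuously_differentiable :: "('a::real_inner \<Rightarrow> real) \<Rightarrow> bool" where
  "continuously_differentiable f \<longleftrightarrow>
     (\<forall>x. f differentiable (at x)) \<and> continuous_on UNIV (grad f)"

definition strongly_convex1 :: "('a::real_inner \<Rightarrow> real) \<Rightarrow> bool" where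
  "strongly_convex1 \<omega> \<longleftrightarrow> convex_on UNIV (\<lambda>x. \<omega> x - 1/2 * (norm x)\<^sup>2)"

definition bregman :: "('a::real_inner \<Rightarrow> real) \<Rightarrow> 'a \<Rightarrow> 'a \<Rightarrow> real" where
  "bregman \<omega> y x = \<omega> y - \<omega> x - grad \<omega> x \<bullet> (y - x)"

definition bregman_sym :: "('a::real_inner \<Rightarrow> real) \<Rightarrow> real \<Rightarrow> 'a \<Rightarrow> 'a \<Rightarrow> real" where
  "bregman_sym \<omega> lam u x = 1 / lam\<^sup>2 * (bregman \<omega> u x + bregman \<omega> x u)"

text \<open>Properness and lower semicontinuity of \<open>\<phi>\<close> are imposed separately.\<close>

definition rel_weakly_convex :: "real \<Rightarrow> ('a::real_inner \<Rightarrow> real) \<Rightarrow> ('a \<Rightarrow> ereal) \<Rightarrow> bool" where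
  "rel_weakly_convex \<rho> \<omega> \<phi> \<longleftrightarrow> ereal_convex (\<lambda>x. \<phi> x + ereal (\<rho> * \<omega> x))"

definition moreau_env ::
    "('a::real_inner \<Rightarrow> real) \<Rightarrow> real \<Rightarrow> ('a \<Rightarrow> ereal) \<Rightarrow> 'a \<Rightarrow> ereal" where
  "moreau_env \<omega> lam F x = (INF y. F y + ereal (1 / lam * bregman \<omega> y x))"

definition prox ::
    "('a::real_inner \<Rightarrow> real) \<Rightarrow> real \<Rightarrow> ('a \<Rightarrow> ereal) \<Rightarrow> 'a \<Rightarrow> 'a" where
  "prox \<omega> lam F x = arg_min (\<lambda>y. F y + ereal (1 / lam * bregman \<omega> y x)) (\<lambda>_. True)"

definition expected_loss :: "'o measure \<Rightarrow> ('a \<Rightarrow> 'o \<Rightarrow> real) \<Rightarrow> 'a \<Rightarrow> real" where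
  "expected_loss P fs x = (\<integral>\<xi>. fs x \<xi> \<partial>P)"

definition objective ::
    "'o measure \<Rightarrow> ('a \<Rightarrow> 'o \<Rightarrow> real) \<Rightarrow> ('a \<Rightarrow> ereal) \<Rightarrow> 'a \<Rightarrow> ereal" where
  "objective P fs r x = ereal (expected_loss P fs x) + r x"

text \<open>
  \<open>fs x \<xi>\<close> is \<open>f(x; \<xi>)\<close> and \<open>fm x y \<xi>\<close> is the model \<open>f\<^sub>x(y; \<xi>)\<close>.
  The integrability clauses say that the expectations exist as real numbers; without them the
  Bochner integral would silently be \<open>0\<close>. For \<open>fm x y\<close> with \<open>x \<noteq> y\<close> this is no more than the
  existence of the expectation bounded in \<open>accuracy\<close>, since \<open>lipschitz\<close> gives an integrable
  lower bound.
\<close>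

locale stochastic_model = prob_space P
  for P :: "'o measure" +
  fixes fs :: "'a::euclidean_space \<Rightarrow> 'o \<Rightarrow> real"
    and r :: "'a \<Rightarrow> ereal"
    and fm :: "'a \<Rightarrow> 'a \<Rightarrow> 'o \<Rightarrow> real"
    and \<omega> :: "'a \<Rightarrow> real"
    and \<tau> \<rho> :: real
    and Lt :: "'a \<Rightarrow> 'o \<Rightarrow> real"
    and L :: "'a \<Rightarrow> real"
  assumes loss_integrable: "\<And>x. integrable P (fs x)"
    and loss_lsc: "AE \<xi> in P. proper (\<lambda>x. ereal (fs x \<xi>)) \<and> lsc (\<lambda>x. ereal (fs x \<xi>))"
    and r_proper: "proper r"
    and r_lsc: "lsc r"
    and model_measurable:
      "(\<lambda>(x, y, \<xi>). fm x y \<xi>) \<in> borel_measurable (borel \<Otimes>\<^sub>M borel \<Otimes>\<^sub>M P)"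
    and model_proper_lsc:
      "\<And>x. AE \<xi> in P. proper (\<lambda>y. ereal (fm x y \<xi>) + r y) \<and> lsc (\<lambda>y. ereal (fm x y \<xi>) + r y)"
    and bounded_below: "(INF x. objective P fs r x) > -\<infinity>"
    and omega_C1: "continuously_differentiable \<omega>"
    and omega_strongly_convex: "strongly_convex1 \<omega>"
    and tau_pos: "\<tau> > 0"
    and rho_pos: "\<rho> > 0"
    and model_integrable: "\<And>x y. integrable P (fm x y)"
    and unbiased: "\<And>x. (\<integral>\<xi>. fm x x \<xi> \<partial>P) = expected_loss P fs x"
    and accuracy: "\<And>x y. (\<integral>\<xi>. (fm x y \<xi> - expected_loss P fs y) \<partial>P)
        \<le> \<tau> * min (bregman \<omega> x y) (bregman \<omega> y x)"
    and weak_convexity: "\<And>x \<xi>. \<xi> \<in> space P \<Longrightarrow>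
        rel_weakly_convex \<rho> \<omega> (\<lambda>y. ereal (fm x y \<xi>) + r y)"
    and Lt_measurable: "(\<lambda>(x, \<xi>). Lt x \<xi>) \<in> borel_measurable (borel \<Otimes>\<^sub>M P)"
    and Lt_nonneg: "\<And>x \<xi>. \<xi> \<in> space P \<Longrightarrow> 0 \<le> Lt x \<xi>"
    and L_nonneg: "\<And>x. 0 \<le> L x"
    and Lt_square_integrable: "\<And>x. integrable P (\<lambda>\<xi>. (Lt x \<xi>)\<^sup>2)"
    and Lt_le_L: "\<And>x. sqrt (\<integral>\<xi>. (Lt x \<xi>)\<^sup>2 \<partial>P) \<le> L x"
    and lipschitz: "\<And>x y. AE \<xi> in P.
        fm x x \<xi> - fm x y \<xi> \<le> Lt x \<xi> * sqrt (min (bregman \<omega> x y) (bregman \<omega> y x))"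

text \<open>
  A run of the method on a probability space \<open>M\<close>, started at \<open>x0\<close>: \<open>\<xi> 0, \<dots>, \<xi> (K - 1)\<close> are
  i.i.d. samples of \<open>P\<close>, the iterates are random vectors \<open>X 0, \<dots>, X K\<close>, and the random index
  \<open>kb\<close> is independent of the whole sample path. The library's \<open>indep_var\<close> needs both variables
  to have the same type, so the independence of \<open>kb\<close> is stated for the generated sigma-algebras.
  The subproblems have a minimizer only almost surely, hence the \<open>AE\<close>.
\<close>

definition model_based_run ::
    "'w measure \<Rightarrow> 'o measure \<Rightarrow> ('a::euclidean_space \<Rightarrow> 'a \<Rightarrow> 'o \<Rightarrow> real) \<Rightarrow> ('a \<Rightarrow> ereal) \<Rightarrow>
     ('a \<Rightarrow> real) \<Rightarrow> (nat \<Rightarrow> real) \<Rightarrow> nat \<Rightarrow> 'a \<Rightarrow> (nat \<Rightarrow> 'w \<Rightarrow> 'o) \<Rightarrow> (nat \<Rightarrow> 'w \<Rightarrow> 'a) \<Rightarrow>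
     ('w \<Rightarrow> nat) \<Rightarrow> bool" where
  "model_based_run M P fm r \<omega> t K x0 \<xi> X kb \<longleftrightarrow>
     prob_space M \<and>
     prob_space.indep_vars M (\<lambda>_. P) \<xi> {..<K} \<and>
     (\<forall>k<K. distr M P (\<xi> k) = P) \<and>
     (\<forall>k\<le>K. X k \<in> borel_measurable M) \<and>
     (\<forall>w\<in>space M. X 0 w = x0) \<and>
     (\<forall>k<K. AE w in M. is_arg_min
        (\<lambda>y. ereal (fm (X k w) y (\<xi> k w)) + r y + ereal (1 / t k * bregman \<omega> y (X k w)))
        (\<lambda>_. True) (X (Suc k) w)) \<and>
     kb \<in> measurable M (count_space {..<K}) \<and>
     (\<forall>k<K. measure M {w \<in> space M. kb w = k} = t k / (\<Sum>i<K. t i)) \<and>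
     prob_space.indep_set M
       (sets (vimage_algebra (space M) (\<lambda>w. \<lambda>i\<in>{..<K}. \<xi> i w) (\<Pi>\<^sub>M i\<in>{..<K}. P)))
       (sets (vimage_algebra (space M) kb (count_space {..<K})))"

end

theory Submission
  imports Defs
begin

text \<open>
  Write \<open>x\<close> for the current iterate, \<open>x'\<close> for the next one, \<open>p\<close> for the proximal point of \<open>x\<close>, and
  \<open>F\<^sub>m\<^sub>i\<^sub>n\<close> for the infimum of \<open>F\<close>. Testing the minimality of \<open>x'\<close> in the subproblem against \<open>p\<close> bounds
  \<open>D(p, x')\<close>, which in turn bounds the envelope at \<open>x'\<close>. The loss at \<open>x'\<close> is compared with the loss
  at \<open>x\<close> by applying accuracy and the Lipschitz condition to the model based at \<open>x'\<close>; the price is a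
  term \<open>L(x')\<^sup>2\<close> beside \<open>L(x)\<^sup>2\<close>. After averaging over the sample, the potential
  \<open>env + t / (\<lambda> (1 - t \<rho>)) (F - F\<^sub>m\<^sub>i\<^sub>n)\<close> decreases by the symmetric Bregman distance up to this noise.
  The two growth conditions are the cases \<open>\<alpha> = 0\<close> and \<open>\<alpha> > 0\<close> of \<open>L\<^sup>2 \<le> \<alpha> (env - F\<^sub>m\<^sub>i\<^sub>n) + \<beta>\<close>, where
  \<open>\<alpha>\<close> is absorbed by taking the largest expected envelope value along the run.
\<close>

section \<open>Bregman distances and convexity\<close>

text \<open>The pathwise decrease is short; most of the work makes its expectation legitimate. A run
  yields some minimizer, almost surely, and nothing says that it depends measurably on the samples.
  So each iterate is identified almost surely with a measurable recursion \<open>iterate\<close> in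
  the samples; only this makes the current iterate independent of the new sample. The exceptional
  set in the Lipschitz condition depends on the point compared, while the next iterate is random: a
  countable set \<open>Q\<close>, dense in the relative interior of the domain of \<open>r\<close>,
  stands in for all points, and convexity reaches the relative boundary from there. No moment of the
  iterates is assumed either: integrability of the objective gap is carried along the run, and
  passing to the next iterate already uses a consequence of the smallness condition on
  \<open>\<alpha>\<close>. The weight t / (\<lambda> (1 - t \<rho>)) in the potential is dictated by
  the proximal inequality: after multiplication by it, D(p, x') has exactly the coefficient 1 /
  \<lambda> that it has in the envelope.\<close>

lemma directional_derivative_nonneg:
  fixes h :: "'a::real_normed_vector \<Rightarrow> real"
  assumes h: "(h has_derivative h') (at x)"
    and le: "\<And>s. 0 < s \<Longrightarrow> s \<le> 1 \<Longrightarrow> 0 \<le> s * c + h (x + s *\<^sub>R d) - h x"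
  shows "0 \<le> c + h' d"
proof -
  have "((\<lambda>s::real. x + s *\<^sub>R d) has_derivative (\<lambda>s. s *\<^sub>R d)) (at 0)"
    by (auto intro!: derivative_eq_intros)
  moreover have "(h has_derivative h') (at (x + (0::real) *\<^sub>R d))"
    using h by simp
  ultimately have "((\<lambda>s::real. h (x + s *\<^sub>R d)) has_derivative (\<lambda>s. h' (s *\<^sub>R d))) (at 0)"
    by (rule has_derivative_compose)
  moreover have "(\<lambda>s. h' (s *\<^sub>R d)) = (*) (h' d)"
    using linear_cmul[OF has_derivative_linear[OF h]] by (auto simp: mult.commute)
  ultimately have "((\<lambda>s::real. h (x + s *\<^sub>R d)) has_field_derivative h' d) (at 0)"
    by (simp add: has_field_derivative_def)
  then have lim: "((\<lambda>s. (h (x + s *\<^sub>R d) - h x) / s) \<longlongrightarrow> h' d) (at_right 0)"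
    by (auto simp: has_field_derivative_iff intro: filterlim_mono at_le)
  have "eventually (\<lambda>s::real. 0 < s \<and> s < 1) (at_right 0)"
    by (auto simp: eventually_at_right_field intro!: exI[of _ 1])
  then have "eventually (\<lambda>s. - c \<le> (h (x + s *\<^sub>R d) - h x) / s) (at_right 0)"
  proof eventually_elim
    case (elim s)
    then show ?case using le[of s] by (simp add: field_simps)
  qed
  then have "- c \<le> h' d"
    using tendsto_lowerbound[OF lim] by simp
  then show ?thesis by simp
qed

text \<open>\<open>grad\<close> is a definite description, so it means something only once a
  gradient exists and is unique; the derivative is represented through its values on the
  basis.\<close>

lemma grad_has_derivative:
  fixes f :: "'a::euclidean_space \<Rightarrow> real"
  assumes "f differentiable (at x)"
  shows "(f has_derivative (\<lambda>h. grad f x \<bullet> h)) (at x)"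
proof -
  obtain f' where f': "(f has_derivative f') (at x)"
    using assms by (auto simp: differentiable_def)
  have lin: "linear f'" using f' by (rule has_derivative_linear)
  define g where "g = (\<Sum>b\<in>Basis. f' b *\<^sub>R b)"
  have "f' = (\<lambda>h. h \<bullet> g)"
  proof
    fix h
    have "f' h = f' (\<Sum>b\<in>Basis. (h \<bullet> b) *\<^sub>R b)"
      by (simp add: euclidean_representation)
    also have "\<dots> = (\<Sum>b\<in>Basis. (h \<bullet> b) * f' b)"
      by (simp add: linear_sum[OF lin] linear_cmul[OF lin])
    also have "\<dots> = h \<bullet> g"
      by (simp add: g_def inner_sum_right mult.commute)
    finally show "f' h = h \<bullet> g" .
  qed
  then have g: "GDERIV f x :> g" using f' by (simp add: gderiv_def)
  have "grad f x = g"
    unfolding grad_def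
  proof (rule the_equality[where P = "\<lambda>g. GDERIV f x :> g", OF g])
    fix k assume "GDERIV f x :> k"
    then have "(\<lambda>h. h \<bullet> k) = (\<lambda>h. h \<bullet> g)"
      using g has_derivative_unique unfolding gderiv_def by blast
    then show "k = g" by (metis vector_eq_ldot)
  qed
  then show ?thesis
    using g by (simp add: gderiv_def inner_commute)
qed

locale C1_strongly_convex =
  fixes \<omega> :: "'a::euclidean_space \<Rightarrow> real"
  assumes C1: "continuously_differentiable \<omega>"
    and strong: "strongly_convex1 \<omega>"
begin

lemma has_derivative_omega: "(\<omega> has_derivative (\<lambda>h. grad \<omega> x \<bullet> h)) (at x)"
  using C1 by (simp add: continuously_differentiable_def grad_has_derivative)

lemma continuous_on_omega: "continuous_on A \<omega>"
  by (meson continuous_at_imp_continuous_on has_derivative_continuous has_derivative_omega)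

lemma continuous_on_grad: "continuous_on A (grad \<omega>)"
  using C1 continuous_on_subset by (auto simp: continuously_differentiable_def)

lemma continuous_on_omega_comp [continuous_intros]:
  "continuous_on A f \<Longrightarrow> continuous_on A (\<lambda>x. \<omega> (f x))"
  using continuous_on_compose2[OF continuous_on_omega[of UNIV]] by auto

lemma continuous_on_grad_comp [continuous_intros]:
  "continuous_on A f \<Longrightarrow> continuous_on A (\<lambda>x. grad \<omega> (f x))"
  using continuous_on_compose2[OF continuous_on_grad[of UNIV]] by auto

lemma continuous_on_bregman [continuous_intros]:
  "continuous_on A f \<Longrightarrow> continuous_on A g \<Longrightarrow> continuous_on A (\<lambda>x. bregman \<omega> (f x) (g x))"
  unfolding bregman_def by (intro continuous_intros)

lemma bregman_self [simp]: "bregman \<omega> x x = 0"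
  by (simp add: bregman_def)

lemma bregman_three_point:
  "bregman \<omega> z x = bregman \<omega> z y + bregman \<omega> y x + (grad \<omega> y - grad \<omega> x) \<bullet> (z - y)"
  by (simp add: bregman_def algebra_simps)

text \<open>The Bregman distance is additive in the generating function: the convex remainder
  \<open>g\<close> contributes a nonnegative amount and the quadratic exactly half the squared
  distance.\<close>

lemma bregman_ge: "bregman \<omega> y x \<ge> (norm (y - x))\<^sup>2 / 2"
proof -
  define g where "g x = \<omega> x - 1/2 * (norm x)\<^sup>2" for x
  have cvx: "convex_on UNIV g"
    using strong unfolding strongly_convex1_def g_def .
  have "((\<lambda>x. 1/2 * (norm x)\<^sup>2) has_derivative (\<lambda>h. x \<bullet> h)) (at x)"
    unfolding power2_norm_eq_inner
    by (auto intro!: derivative_eq_intros simp: inner_commute)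
  then have "(g has_derivative (\<lambda>h. grad \<omega> x \<bullet> h - x \<bullet> h)) (at x)"
    unfolding g_def using has_derivative_omega by (intro derivative_intros)
  \<comment> \<open>Convexity bounds \<open>g\<close> along the segment from above, so
    \<open>- g\<close> is taken as the differentiable function and the chord slope
    \<open>g y - g x\<close> as the linear term.\<close>
  then have "((\<lambda>x. - g x) has_derivative (\<lambda>h. - (grad \<omega> x \<bullet> h - x \<bullet> h))) (at x)"
    by (intro derivative_intros)
  then have "0 \<le> (g y - g x) + - (grad \<omega> x \<bullet> (y - x) - x \<bullet> (y - x))"
  proof (rule directional_derivative_nonneg)
    fix s :: real assume s: "0 < s" "s \<le> 1"
    have "x + s *\<^sub>R (y - x) = (1 - s) *\<^sub>R x + s *\<^sub>R y"
      by (simp add: algebra_simps)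
    then have "g (x + s *\<^sub>R (y - x)) \<le> (1 - s) * g x + s * g y"
      using convex_onD[OF cvx, of s x y] s by simp
    then show "0 \<le> s * (g y - g x) + - g (x + s *\<^sub>R (y - x)) - - g x"
      by (simp add: algebra_simps)
  qed
  then show ?thesis
    unfolding g_def bregman_def power2_norm_eq_inner
    by (simp add: inner_diff_left inner_diff_right inner_commute[of y x] field_simps)
qed

lemma bregman_nonneg [simp]: "0 \<le> bregman \<omega> y x"
  using bregman_ge[of y x] by (smt (verit) divide_nonneg_pos zero_le_power2)

text \<open>The gradient terms cancel because \<open>z\<close> is the weighted mean; what remains is
  the Jensen gap of \<omega>. This is how an error \<tau> D turns into a multiple of \<omega> in a
  convexity modulus.\<close>

lemma bregman_convex_combination:
  assumes "u + v = 1" "z = u *\<^sub>R x + v *\<^sub>R y"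
  shows "u * bregman \<omega> x z + v * bregman \<omega> y z = u * \<omega> x + v * \<omega> y - \<omega> z"
proof -
  have "u *\<^sub>R (x - z) + v *\<^sub>R (y - z) = z - (u + v) *\<^sub>R z"
    unfolding assms(2) by (simp only: algebra_simps)
  then have "u *\<^sub>R (x - z) + v *\<^sub>R (y - z) = 0" using assms(1) by simp
  then have "grad \<omega> z \<bullet> (u *\<^sub>R (x - z) + v *\<^sub>R (y - z)) = 0" by simp
  then have "u * (grad \<omega> z \<bullet> (x - z)) + v * (grad \<omega> z \<bullet> (y - z)) = 0"
    by (simp add: inner_add_right)
  moreover have "(u + v) * \<omega> z = \<omega> z" using assms(1) by simp
  ultimately show ?thesis
    unfolding bregman_def by (simp add: algebra_simps)
qed

text \<open>Optimality without subgradients: the objective is a convex \<open>g\<close> plus a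
  differentiable \<open>h\<close>. Along the segment to \<open>y\<close> the convex part is replaced
  by its chord slope and only \<open>h\<close> is differentiated. The three-point identity turns the
  gradient term into distances and leaves the surplus
  \<open>(c - \<rho>) * bregman \<omega> y z\<close>.\<close>

lemma prox_inequality:
  assumes cvx: "convex_on S (\<lambda>y. \<phi> y + \<rho> * \<omega> y)"
    and z: "z \<in> S" and y: "y \<in> S"
    and min: "\<And>y. y \<in> S \<Longrightarrow> \<phi> z + c * bregman \<omega> z x \<le> \<phi> y + c * bregman \<omega> y x"
  shows "\<phi> z + c * bregman \<omega> z x + (c - \<rho>) * bregman \<omega> y z \<le> \<phi> y + c * bregman \<omega> y x"
proof -
  define g where "g y = \<phi> y + \<rho> * \<omega> y" for y
  define h where "h y = c * bregman \<omega> y x - \<rho> * \<omega> y" for y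
  have gh: "\<phi> y + c * bregman \<omega> y x = g y + h y" for y
    by (simp add: g_def h_def)
  have hd: "(h has_derivative (\<lambda>k. c * (grad \<omega> z \<bullet> k - grad \<omega> x \<bullet> k) - \<rho> * (grad \<omega> z \<bullet> k))) (at z)"
    unfolding h_def bregman_def
    by (auto intro!: derivative_eq_intros has_derivative_omega)
  have "0 \<le> (g y - g z) + (c * (grad \<omega> z \<bullet> (y - z) - grad \<omega> x \<bullet> (y - z)) - \<rho> * (grad \<omega> z \<bullet> (y - z)))"
  proof (rule directional_derivative_nonneg[OF hd])
    fix s :: real assume s: "0 < s" "s \<le> 1"
    have eq: "z + s *\<^sub>R (y - z) = (1 - s) *\<^sub>R z + s *\<^sub>R y"
      by (simp add: algebra_simps)
    have "z + s *\<^sub>R (y - z) \<in> S"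
      unfolding eq using convex_on_imp_convex[OF cvx] z y s by (simp add: convexD)
    then have "g z + h z \<le> g (z + s *\<^sub>R (y - z)) + h (z + s *\<^sub>R (y - z))"
      using min by (simp add: gh)
    moreover have "g (z + s *\<^sub>R (y - z)) \<le> (1 - s) * g z + s * g y"
      using convex_onD[OF cvx, of s z y] s z y unfolding eq g_def by simp
    ultimately show "0 \<le> s * (g y - g z) + h (z + s *\<^sub>R (y - z)) - h z"
      by (simp add: algebra_simps)
  qed
  then have "g z + \<rho> * (grad \<omega> z \<bullet> (y - z)) \<le> g y + c * ((grad \<omega> z - grad \<omega> x) \<bullet> (y - z))"
    by (simp add: inner_diff_left algebra_simps)
  moreover have "(grad \<omega> z - grad \<omega> x) \<bullet> (y - z) = bregman \<omega> y x - bregman \<omega> y z - bregman \<omega> z x"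
    using bregman_three_point[of y x z] by simp
  moreover have "grad \<omega> z \<bullet> (y - z) = \<omega> y - \<omega> z - bregman \<omega> y z"
    by (simp add: bregman_def)
  ultimately have "g z + \<rho> * (\<omega> y - \<omega> z - bregman \<omega> y z)
      \<le> g y + c * (bregman \<omega> y x - bregman \<omega> y z - bregman \<omega> z x)"
    by simp
  then show ?thesis
    unfolding g_def by (simp add: right_diff_distrib left_diff_distrib)
qed

end

section \<open>Finite convex functions on and near the relative interior\<close>

text \<open>Composition with an affine projection \<open>q\<close> onto the affine hull moves the
  problem to the full space: the preimage of the relative interior is open there, a finite convex
  function is continuous on an open convex set, and \<open>q\<close> fixes the hull.\<close>

lemma convex_on_continuous_on_rel_interior:
  fixes g :: "'a::euclidean_space \<Rightarrow> real"
  assumes cvx: "convex_on S g"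
  shows "continuous_on (rel_interior S) g"
proof (cases "rel_interior S = {}")
  case False
  then obtain a where a: "a \<in> rel_interior S" by blast
  let ?A = "affine hull S"
  have sub: "rel_interior S \<subseteq> ?A"
    by (rule order_trans[OF rel_interior_subset hull_subset])
  then have aA: "a \<in> ?A" using a by (rule subsetD)
  define V where "V = (\<lambda>x. x - a) ` ?A"
  have V: "subspace V"
    unfolding V_def using aA affine_diffs_subspace_subtract[of ?A a] by simp
  have "linear (\<lambda>x::'a. x)" by (rule linearI) simp_all
  then obtain p where p: "range p \<subseteq> V" "linear p" "\<forall>v\<in>V. p v = v"
    using linear_exists_left_inverse_on[of "\<lambda>x. x" V] V by auto
  define q where "q y = a + p (y - a)" for y
  have qA: "q y \<in> ?A" for y
  proof -
    have "p (y - a) \<in> (\<lambda>x. x - a) ` ?A" using p(1) unfolding V_def by blast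
    then show ?thesis unfolding q_def by auto
  qed
  have qid: "q y = y" if "y \<in> ?A" for y
  proof -
    have "y - a \<in> V" unfolding V_def using that by blast
    then show ?thesis unfolding q_def using p(3) by simp
  qed
  have cont: "continuous_on UNIV q"
    unfolding q_def
    by (intro continuous_intros linear_continuous_on_compose[OF _ p(2)])
  have aff: "q (u *\<^sub>R x + v *\<^sub>R y) = u *\<^sub>R q x + v *\<^sub>R q y" if "u + v = 1" for u v x y
  proof -
    have v: "v = 1 - u" using that by simp
    have "u *\<^sub>R x + v *\<^sub>R y - a = u *\<^sub>R (x - a) + v *\<^sub>R (y - a)"
      by (simp add: v algebra_simps)
    then have "p (u *\<^sub>R x + v *\<^sub>R y - a) = u *\<^sub>R p (x - a) + v *\<^sub>R p (y - a)"
      by (simp only: linear_add[OF p(2)] linear_cmul[OF p(2)])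
    then show ?thesis
      by (simp add: q_def v algebra_simps)
  qed
  define U where "U = q -` rel_interior S"
  have "open U"
  proof -
    obtain W where W: "open W" "rel_interior S = ?A \<inter> W"
      using openin_rel_interior[of S] unfolding openin_open by blast
    have "U = q -` W"
      unfolding U_def W(2) vimage_Int using qA by blast
    then show ?thesis using cont W(1) by (simp add: continuous_on_open_vimage)
  qed
  have gri: "convex_on (rel_interior S) g"
    using convex_on_subset[OF cvx rel_interior_subset]
      convex_rel_interior[OF convex_on_imp_convex[OF cvx]] by blast
  have "convex_on U (\<lambda>y. g (q y))"
    unfolding convex_on_def
  proof (intro conjI ballI allI impI)
    show "convex U"
      using convex_on_imp_convex[OF gri] by (simp add: convex_def U_def aff)
    fix x y and u v :: real
    assume "x \<in> U" "y \<in> U" "0 \<le> u" "0 \<le> v" "u + v = 1"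
    then show "g (q (u *\<^sub>R x + v *\<^sub>R y)) \<le> u * g (q x) + v * g (q y)"
      using gri by (simp add: aff U_def convex_on_def)
  qed
  then have "continuous_on U (\<lambda>y. g (q y))"
    by (rule convex_on_continuous[OF \<open>open U\<close>])
  moreover have "rel_interior S \<subseteq> U"
    unfolding U_def using sub qid by (metis subsetD subsetI vimageI)
  ultimately have "continuous_on (rel_interior S) (\<lambda>y. g (q y))"
    by (rule continuous_on_subset)
  moreover have "g (q y) = g y" if "y \<in> rel_interior S" for y
    using sub qid that by (metis subsetD)
  ultimately show ?thesis
    by (simp cong: continuous_on_cong)
qed simp

text \<open>A convex function may jump up at relative boundary points, so density of
  \<open>Q\<close> alone gives no control of values. Sliding \<open>x\<close> towards a point
  \<open>c\<close> of the relative interior raises \<open>g\<close> by at most a linear amount, and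
  continuity at the resulting point \<open>z\<close> allows \<open>z\<close> to be replaced by a
  point of \<open>Q\<close>.\<close>

lemma convex_on_dense_approx:
  fixes g :: "'a::euclidean_space \<Rightarrow> real"
  assumes cvx: "convex_on S g" and x: "x \<in> S" and e: "0 < e"
    and Q: "Q \<subseteq> rel_interior S" "rel_interior S \<subseteq> closure Q"
  obtains q where "q \<in> Q" "dist q x < e" "g q < g x + e"
proof -
  have convS: "convex S" using cvx by (rule convex_on_imp_convex)
  have "rel_interior S \<noteq> {}" using x convS rel_interior_eq_empty by blast
  then obtain c where c: "c \<in> rel_interior S" by blast
  then have cS: "c \<in> S" using rel_interior_subset by blast
  \<comment> \<open>\<open>B\<close> strictly exceeds both the displacement and the increase of
    \<open>g\<close> per unit of \<open>s\<close>, so each of them costs less than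
    \<open>e / 2\<close>.\<close>
  define B where "B = norm (x - c) + \<bar>g c - g x\<bar> + 1"
  have B: "B > 0" unfolding B_def by (smt (verit) norm_ge_zero)
  define s where "s = min 1 (e / (2 * B))"
  have s: "0 < s" "s \<le> 1" "s * B \<le> e / 2"
    using B e by (auto simp: s_def min_def field_simps)
  define z where "z = x - s *\<^sub>R (x - c)"
  have z: "z \<in> rel_interior S"
    unfolding z_def using convS c x s by (intro rel_interior_convex_shrink)
  have "dist z x = s * norm (x - c)" using s by (simp add: z_def dist_norm)
  also have "\<dots> < s * B" using s by (simp add: B_def)
  finally have dz: "dist z x < e / 2" using s by simp
  have "z = (1 - s) *\<^sub>R x + s *\<^sub>R c" by (simp add: z_def algebra_simps)
  then have "g z \<le> (1 - s) * g x + s * g c"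
    using convex_onD[OF cvx, of s x c] s x cS by simp
  also have "\<dots> = g x + s * (g c - g x)" by (simp add: algebra_simps)
  also have "s * (g c - g x) < s * B"
    using s by (simp add: B_def) (smt (verit) norm_ge_zero)
  finally have gz: "g z < g x + e / 2" using s by simp
  have "continuous_on (rel_interior S) g" by (rule convex_on_continuous_on_rel_interior[OF cvx])
  then obtain d where d: "d > 0" "\<And>y. y \<in> rel_interior S \<Longrightarrow> dist y z < d \<Longrightarrow> dist (g y) (g z) < e / 2"
    using z e unfolding continuous_on_iff by (metis half_gt_zero)
  obtain q where q: "q \<in> Q" "dist q z < min d (e / 2)"
    using z Q(2) d(1) e closure_approachable[of z Q]
    by (metis half_gt_zero min_less_iff_conj subsetD)
  show thesis
  proof
    show "q \<in> Q" by fact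
    show "dist q x < e" using q(2) dz dist_triangle[of q x z] by simp
    show "g q < g x + e" using d(2)[of q] q Q(1) gz abs_ge_self[of "g q - g z"]
      by (auto simp: dist_real_def subset_eq)
  qed
qed

section \<open>Lower semicontinuity in the extended reals\<close>

text \<open>A strict lower bound on a sum can be split at a real number \<open>b\<close>, which
  writes the set as a union of intersections of open sets. The summand \<open>g\<close> is
  real-valued, so no undefined sum occurs.\<close>

lemma lsc_add:
  assumes g: "lsc (\<lambda>x. ereal (g x))" and r: "lsc r"
  shows "lsc (\<lambda>x. ereal (g x) + r x)"
  unfolding lsc_def
proof
  fix a
  have "{x. a < ereal (g x) + r x} = (\<Union>b. {x. ereal b < ereal (g x)} \<inter> {x. a - ereal b < r x})"
  proof (intro set_eqI iffI)
    fix x assume "x \<in> {x. a < ereal (g x) + r x}"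
    then have "a < r x + ereal (g x)" by (simp add: add.commute)
    then have "a - r x < ereal (g x) \<or> r x = \<infinity> \<and> a < \<infinity>"
      by (cases a; cases "r x") auto
    then obtain b where "ereal b < ereal (g x)" "a - ereal b < r x"
    proof
      assume *: "a - r x < ereal (g x)"
      then obtain b where "a - r x < ereal b" "ereal b < ereal (g x)"
        using ereal_dense2 by blast
      moreover from this(1) \<open>a < r x + ereal (g x)\<close> have "a - ereal b < r x"
        by (cases a; cases "r x") auto
      ultimately show ?thesis using that by blast
    next
      assume "r x = \<infinity> \<and> a < \<infinity>"
      then show ?thesis using that[of "g x - 1"] by (cases a) auto
    qed
    then show "x \<in> (\<Union>b. {x. ereal b < ereal (g x)} \<inter> {x. a - ereal b < r x})" by blast
  next
    fix x assume "x \<in> (\<Union>b. {x. ereal b < ereal (g x)} \<inter> {x. a - ereal b < r x})"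
    then obtain b where "b < g x" "a - ereal b < r x" by auto
    then show "x \<in> {x. a < ereal (g x) + r x}"
      by (cases a; cases "r x") auto
  qed
  moreover have "open (\<Union>b. {x. ereal b < ereal (g x)} \<inter> {x. a - ereal b < r x})"
    using g[unfolded lsc_def] r[unfolded lsc_def] by (intro open_UN ballI open_Int) blast+
  ultimately show "open {x. a < ereal (g x) + r x}"
    by (simp only:)
qed

text \<open>Without a minimizer, the open sets where \<open>\<phi>\<close> exceeds its value at some
  \<open>y\<close> of \<open>C\<close> cover \<open>C\<close>; among the finitely many
  \<open>y\<close> of a subcover, the one with the least value is not covered.\<close>

lemma lsc_attains_inf_compact:
  fixes \<phi> :: "'a::topological_space \<Rightarrow> ereal"
  assumes "lsc \<phi>" "compact C" "C \<noteq> {}"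
  obtains x where "x \<in> C" "\<And>y. y \<in> C \<Longrightarrow> \<phi> x \<le> \<phi> y"
proof (rule ccontr)
  assume "\<not> thesis"
  then have "\<forall>x\<in>C. \<exists>y\<in>C. \<phi> y < \<phi> x" using that by (metis not_le)
  then have "C \<subseteq> (\<Union>y\<in>C. {x. \<phi> y < \<phi> x})" by blast
  moreover have "\<forall>y\<in>C. open {x. \<phi> y < \<phi> x}" using assms(1) by (simp add: lsc_def)
  ultimately obtain D where D: "D \<subseteq> C" "finite D" "C \<subseteq> (\<Union>y\<in>D. {x. \<phi> y < \<phi> x})"
    using compactE_image[OF assms(2)] by metis
  then have "D \<noteq> {}" using assms(3) by blast
  then obtain d where "d \<in> D" "\<And>y. y \<in> D \<Longrightarrow> \<phi> d \<le> \<phi> y"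
    using ex_min_if_finite[of "\<phi> ` D"] D(2) by (auto simp: not_less)
  then show False using D by (metis (mono_tags, lifting) UN_E mem_Collect_eq not_le subsetD)
qed

lemma lsc_borel_measurable:
  assumes "lsc (\<phi> :: 'a::topological_space \<Rightarrow> ereal)"
  shows "\<phi> \<in> borel_measurable borel"
  using assms by (intro borel_measurableI_greater) (auto simp: lsc_def)

text \<open>Completing the square gives (a + b)^2 / (4 c); the added term
  \<open>(a - b)\<^sup>2\<close> separates the two coefficients at the price of a factor 2.\<close>

lemma young_quadratic:
  fixes a b c s :: real
  assumes "0 < c"
  shows "(a + b) * s - c * s\<^sup>2 \<le> (a\<^sup>2 + b\<^sup>2) / (2 * c)"
proof -
  have "0 \<le> (2 * c * s - (a + b))\<^sup>2 + (a - b)\<^sup>2" by simp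
  then have "4 * c * ((a + b) * s - c * s\<^sup>2) \<le> 2 * (a\<^sup>2 + b\<^sup>2)"
    by (simp add: power2_eq_square algebra_simps)
  then show ?thesis using assms by (simp add: field_simps)
qed

lemma sqrt_mult_le_half: "0 \<le> a \<Longrightarrow> 0 \<le> b \<Longrightarrow> sqrt a * sqrt b \<le> (a + b) / 2"
  using arith_geo_mean_sqrt[of a b] by (simp add: real_sqrt_mult)

section \<open>Deterministic properties of the model\<close>

text \<open>Finite values at the endpoints force a finite value in between, so convexity of the
  domain comes along with the inequality.\<close>

lemma ereal_convex_imp_convex_on:
  assumes cvx: "ereal_convex (\<lambda>y. ereal (h y) + r y + ereal (c y))"
    and r: "\<And>x. r x \<noteq> -\<infinity>"
  shows "convex_on {x. r x < \<infinity>} (\<lambda>y. h y + real_of_ereal (r y) + c y)"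
proof -
  have rr: "r x = ereal (real_of_ereal (r x))" if "r x < \<infinity>" for x
    using that r[of x] by (cases "r x") auto
  have *: "r z < \<infinity> \<and> h z + real_of_ereal (r z) + c z
      \<le> u * (h x + real_of_ereal (r x) + c x) + v * (h y + real_of_ereal (r y) + c y)"
    if "r x < \<infinity>" "r y < \<infinity>" "0 \<le> u" "0 \<le> v" "u + v = 1" "z = u *\<^sub>R x + v *\<^sub>R y" for x y z u v
  proof -
    have "ereal (h z) + r z + ereal (c z)
      \<le> ereal u * (ereal (h x) + r x + ereal (c x)) + ereal v * (ereal (h y) + r y + ereal (c y))"
      using cvx that(3-6) unfolding ereal_convex_def by blast
    then show ?thesis
      using r[of z] rr[OF that(1)] rr[OF that(2)] by (cases "r z"; cases "r x"; cases "r y") auto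
  qed
  show ?thesis
    unfolding convex_on_def convex_def using * by blast
qed

sublocale stochastic_model \<subseteq> C1_strongly_convex \<omega>
  using omega_C1 omega_strongly_convex by unfold_locales

context stochastic_model
begin

abbreviation f where "f \<equiv> expected_loss P fs"

definition dom_r where "dom_r = {x. r x < \<infinity>}"

definition rr where "rr x = real_of_ereal (r x)"

definition Fr where "Fr x = f x + rr x"

definition Fmin where "Fmin = real_of_ereal (INF x. objective P fs r x)"

text \<open>Takes the place of the square of \<open>L\<close>, which carries no measurability
  assumption; this function is measurable and can be averaged along the run.\<close>

definition lip2 where "lip2 x = (\<integral>\<xi>. (Lt x \<xi>)\<^sup>2 \<partial>P)"

lemma r_not_MInf: "r x \<noteq> -\<infinity>"
  using r_proper by (simp add: proper_def)

lemma r_eq: "x \<in> dom_r \<Longrightarrow> r x = ereal (rr x)"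
  using r_not_MInf[of x] by (cases "r x") (auto simp: dom_r_def rr_def)

lemma r_outside: "x \<notin> dom_r \<Longrightarrow> r x = \<infinity>"
  by (auto simp: dom_r_def)

lemma objective_eq: "x \<in> dom_r \<Longrightarrow> objective P fs r x = ereal (Fr x)"
  by (simp add: objective_def r_eq Fr_def)

lemma objective_outside: "x \<notin> dom_r \<Longrightarrow> objective P fs r x = \<infinity>"
  by (simp add: objective_def r_outside)

lemma dom_r_nonempty: "dom_r \<noteq> {}"
  using r_proper by (auto simp: proper_def dom_r_def)

lemma Fmin_ereal: "(INF x. objective P fs r x) = ereal Fmin"
proof -
  obtain x where "x \<in> dom_r" using dom_r_nonempty by blast
  then have "(INF x. objective P fs r x) \<le> ereal (Fr x)"
    by (intro INF_lower2[of x]) (auto simp: objective_eq)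
  then show ?thesis
    using bounded_below unfolding Fmin_def by (cases "INF x. objective P fs r x") auto
qed

lemma Fmin_le: "x \<in> dom_r \<Longrightarrow> Fmin \<le> Fr x"
  using INF_lower[of x UNIV "objective P fs r"] unfolding Fmin_ereal by (simp add: objective_eq)

lemma lip2_nonneg: "0 \<le> lip2 x"
  unfolding lip2_def by simp

lemma lip2_le: "lip2 x \<le> (L x)\<^sup>2"
  using Lt_le_L[of x] L_nonneg[of x] unfolding lip2_def[symmetric]
  by (simp add: sqrt_le_D)

lemma model_convex:
  "\<xi> \<in> space P \<Longrightarrow> convex_on dom_r (\<lambda>y. fm x y \<xi> + rr y + \<rho> * \<omega> y)"
  unfolding dom_r_def rr_def
  using weak_convexity[of \<xi> x] r_not_MInf
  by (intro ereal_convex_imp_convex_on) (auto simp: rel_weakly_convex_def)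

lemma convex_dom_r: "convex dom_r"
proof -
  obtain \<xi> where "\<xi> \<in> space P" using not_empty by blast
  then show ?thesis using model_convex convex_on_imp_convex by blast
qed

lemma Lt_measurable' [measurable]: "Lt x \<in> borel_measurable P"
  using measurable_Pair2[OF Lt_measurable, of x] by simp

lemma Lt_integrable: "integrable P (Lt x)"
  by (rule square_integrable_imp_integrable[OF Lt_measurable' Lt_square_integrable])

lemma expectation_Lt_le: "(\<integral>\<xi>. Lt x \<xi> \<partial>P) \<le> sqrt (lip2 x)"
proof -
  have "(\<integral>\<xi>. Lt x \<xi> \<partial>P)\<^sup>2 \<le> lip2 x"
    using variance_positive[of "Lt x"] variance_eq[OF Lt_integrable Lt_square_integrable, of x]
    unfolding lip2_def by simp
  then show ?thesis by (rule real_le_rsqrt)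
qed

text \<open>Everything is measured with the model based at \<open>x\<close>, the point whose loss is
  bounded from above: it is exact on average there, falls by at most the Lipschitz amount on the way
  to \<open>y\<close>, and overestimates the loss at \<open>y\<close> by at most \<tau> D on
  average.\<close>

lemma loss_diff_le:
  assumes m: "m = min (bregman \<omega> x y) (bregman \<omega> y x)"
  shows "f x - f y \<le> sqrt (lip2 x) * sqrt m + \<tau> * m"
proof -
  have "(\<integral>\<xi>. fm x x \<xi> - fm x y \<xi> \<partial>P) \<le> (\<integral>\<xi>. Lt x \<xi> * sqrt m \<partial>P)"
    using lipschitz[of x y] unfolding m[symmetric]
    by (intro integral_mono_AE Bochner_Integration.integrable_diff model_integrable
        Bochner_Integration.integrable_mult_left Lt_integrable)
  also have "\<dots> \<le> sqrt (lip2 x) * sqrt m"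
    using expectation_Lt_le[of x] m by (simp add: mult_right_mono)
  finally have "f x - (\<integral>\<xi>. fm x y \<xi> \<partial>P) \<le> sqrt (lip2 x) * sqrt m"
    by (simp add: model_integrable unbiased)
  moreover have "(\<integral>\<xi>. fm x y \<xi> \<partial>P) - f y \<le> \<tau> * m"
    using accuracy[of x y] unfolding m by (simp add: model_integrable prob_space)
  ultimately show ?thesis by simp
qed

lemma loss_diff_le_bregman:
  "f x - f y \<le> sqrt (lip2 x) * sqrt (bregman \<omega> x y) + \<tau> * bregman \<omega> x y"
  "f x - f y \<le> sqrt (lip2 x) * sqrt (bregman \<omega> y x) + \<tau> * bregman \<omega> y x"
proof -
  define m where "m = min (bregman \<omega> x y) (bregman \<omega> y x)"
  have *: "sqrt (lip2 x) * sqrt m + \<tau> * m \<le> sqrt (lip2 x) * sqrt D + \<tau> * D" if "m \<le> D" for D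
    using that tau_pos lip2_nonneg[of x] by (intro add_mono mult_left_mono) auto
  show "f x - f y \<le> sqrt (lip2 x) * sqrt (bregman \<omega> x y) + \<tau> * bregman \<omega> x y"
    "f x - f y \<le> sqrt (lip2 x) * sqrt (bregman \<omega> y x) + \<tau> * bregman \<omega> y x"
    using loss_diff_le[OF m_def] *[of "bregman \<omega> x y"] *[of "bregman \<omega> y x"] by (auto simp: m_def)
qed

text \<open>The model is based at the convex combination \<open>z\<close> itself: there it is exact
  on average, while at the endpoints it exceeds the loss by at most \<tau> D. The weighted sum of
  these errors is \<tau> times the Jensen gap of \<omega>, which adds \<tau> to the modulus \<rho>
  of the samples.\<close>

lemma objective_weakly_convex: "convex_on dom_r (\<lambda>y. Fr y + (\<tau> + \<rho>) * \<omega> y)"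
  unfolding convex_on_def
proof (intro conjI ballI allI impI convex_dom_r)
  fix x y and u v :: real
  assume xy: "x \<in> dom_r" "y \<in> dom_r" and uv: "0 \<le> u" "0 \<le> v" "u + v = 1"
  define z where "z = u *\<^sub>R x + v *\<^sub>R y"
  have E: "(\<integral>\<xi>. fm z y \<xi> + rr y + \<rho> * \<omega> y \<partial>P) = (\<integral>\<xi>. fm z y \<xi> \<partial>P) + rr y + \<rho> * \<omega> y" for y
    by (simp add: model_integrable prob_space)
  have acc: "(\<integral>\<xi>. fm z y \<xi> \<partial>P) \<le> f y + \<tau> * bregman \<omega> y z" for y
  proof -
    have "(\<integral>\<xi>. fm z y \<xi> \<partial>P) - f y \<le> \<tau> * min (bregman \<omega> z y) (bregman \<omega> y z)"
      using accuracy[of z y] by (simp add: model_integrable prob_space)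
    also have "\<dots> \<le> \<tau> * bregman \<omega> y z" using tau_pos by (intro mult_left_mono) auto
    finally show ?thesis by simp
  qed
  have "(\<integral>\<xi>. fm z z \<xi> + rr z + \<rho> * \<omega> z \<partial>P)
      \<le> (\<integral>\<xi>. u * (fm z x \<xi> + rr x + \<rho> * \<omega> x) + v * (fm z y \<xi> + rr y + \<rho> * \<omega> y) \<partial>P)"
    using model_convex[of _ z] xy uv unfolding convex_on_def z_def
    by (intro integral_mono Bochner_Integration.integrable_add
        Bochner_Integration.integrable_mult_right model_integrable integrable_const) auto
  also have "\<dots> = u * ((\<integral>\<xi>. fm z x \<xi> \<partial>P) + rr x + \<rho> * \<omega> x) + v * ((\<integral>\<xi>. fm z y \<xi> \<partial>P) + rr y + \<rho> * \<omega> y)"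
    by (simp only: E[symmetric]) (simp add: model_integrable)
  also have "\<dots> \<le> u * (f x + \<tau> * bregman \<omega> x z + rr x + \<rho> * \<omega> x)
      + v * (f y + \<tau> * bregman \<omega> y z + rr y + \<rho> * \<omega> y)"
    using acc uv by (intro add_mono mult_left_mono order_refl) auto
  also have "\<dots> = u * (Fr x + \<rho> * \<omega> x) + v * (Fr y + \<rho> * \<omega> y)
      + \<tau> * (u * bregman \<omega> x z + v * bregman \<omega> y z)"
    by (simp add: Fr_def algebra_simps)
  also have "u * bregman \<omega> x z + v * bregman \<omega> y z = u * \<omega> x + v * \<omega> y - \<omega> z"
    using uv(3) z_def by (rule bregman_convex_combination)
  finally have "Fr z + \<rho> * \<omega> z
      \<le> u * (Fr x + \<rho> * \<omega> x) + v * (Fr y + \<rho> * \<omega> y) + \<tau> * (u * \<omega> x + v * \<omega> y - \<omega> z)"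
    unfolding E unbiased Fr_def .
  then show "Fr (u *\<^sub>R x + v *\<^sub>R y) + (\<tau> + \<rho>) * \<omega> (u *\<^sub>R x + v *\<^sub>R y)
      \<le> u * (Fr x + (\<tau> + \<rho>) * \<omega> x) + v * (Fr y + (\<tau> + \<rho>) * \<omega> y)"
    unfolding z_def[symmetric] by (simp add: algebra_simps)
qed

text \<open>For fixed \<open>x\<close>, \<open>loss_diff_le_bregman\<close> provides a continuous
  minorant \<open>h\<close> of the loss that touches it at \<open>x\<close>.\<close>

lemma open_loss_greater: "open {x. a < f x}"
proof (subst open_subopen, intro ballI)
  fix x assume "x \<in> {x. a < f x}"
  then have x: "a < f x" by simp
  define h where "h y = f x - (sqrt (lip2 x) * sqrt (bregman \<omega> x y) + \<tau> * bregman \<omega> x y)" for y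
  have "continuous_on UNIV h"
    unfolding h_def by (intro continuous_intros)
  then have "open {y. a < h y}" by (intro open_Collect_less continuous_on_const)
  moreover have "x \<in> {y. a < h y}" using x by (simp add: h_def)
  moreover have "h y \<le> f y" for y
    using loss_diff_le_bregman(1)[of x y] by (simp add: h_def)
  then have "{y. a < h y} \<subseteq> {x. a < f x}" using less_le_trans by blast
  ultimately show "\<exists>T. open T \<and> x \<in> T \<and> T \<subseteq> {x. a < f x}" by blast
qed

lemma loss_measurable [measurable]: "f \<in> borel_measurable borel"
  using open_loss_greater by (simp add: borel_measurable_iff_greater)

lemma rr_measurable [measurable]: "rr \<in> borel_measurable borel"
  unfolding rr_def[abs_def] using lsc_borel_measurable[OF r_lsc] by measurable

lemma Fr_measurable [measurable]: "Fr \<in> borel_measurable borel"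
  unfolding Fr_def[abs_def] by measurable

lemma lip2_measurable [measurable]: "lip2 \<in> borel_measurable borel"
proof -
  have [measurable]: "(\<lambda>(x, \<xi>). Lt x \<xi>) \<in> borel_measurable (borel \<Otimes>\<^sub>M P)" by (rule Lt_measurable)
  show ?thesis unfolding lip2_def[abs_def] by measurable
qed

lemma objective_lsc: "lsc (objective P fs r)"
proof -
  have "lsc (\<lambda>x. ereal (f x))"
    unfolding lsc_def
  proof
    fix a
    show "open {x. a < ereal (f x)}"
      using open_loss_greater by (cases a) auto
  qed
  then show ?thesis
    using lsc_add[OF _ r_lsc] unfolding objective_def[abs_def] by blast
qed

section \<open>A countable substitute for the domain of r\<close>

text \<open>Dense in the relative interior rather than in \<open>dom_r\<close>:
  \<open>convex_on_dense_approx\<close> needs its points where convex functions are continuous, and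
  reaches all of \<open>dom_r\<close> from there.\<close>

definition Q where
  "Q = (SOME Q. countable Q \<and> Q \<subseteq> rel_interior dom_r \<and> rel_interior dom_r \<subseteq> closure Q)"

lemma Q: "countable Q" "Q \<subseteq> rel_interior dom_r" "rel_interior dom_r \<subseteq> closure Q"
proof -
  have "\<exists>Q. countable Q \<and> Q \<subseteq> rel_interior dom_r \<and> rel_interior dom_r \<subseteq> closure Q"
    using separable[of "rel_interior dom_r"] by metis
  from someI_ex[OF this]
  show "countable Q" "Q \<subseteq> rel_interior dom_r" "rel_interior dom_r \<subseteq> closure Q"
    unfolding Q_def by auto
qed

lemma Q_subset: "Q \<subseteq> dom_r"
  using Q(2) rel_interior_subset by blast

lemma Q_nonempty: "Q \<noteq> {}"
  using Q(3) rel_interior_eq_empty[OF convex_dom_r] dom_r_nonempty by auto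

text \<open>
  The null set excluded in the Lipschitz condition may depend on the second point; lower
  semicontinuity of \<open>r\<close> reduces the condition to countably many points.
\<close>

lemma lipschitz_from_Q:
  assumes \<xi>: "\<xi> \<in> space P" and y: "y \<in> dom_r"
    and le: "\<And>q. q \<in> Q \<Longrightarrow> fm x x \<xi> - fm x q \<xi> \<le> Lt x \<xi> * sqrt (bregman \<omega> q x)"
  shows "fm x x \<xi> - fm x y \<xi> \<le> Lt x \<xi> * sqrt (bregman \<omega> y x)"
proof (rule field_le_epsilon)
  fix e :: real assume e: "0 < e"
  define g where "g y = fm x y \<xi> + rr y + \<rho> * \<omega> y" for y
  have g: "convex_on dom_r g" using model_convex[OF \<xi>, of x] unfolding g_def[abs_def] .
  have "\<exists>q. q \<in> Q \<and> dist q y < inverse (Suc n) \<and> g q < g y + inverse (Suc n)" for n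
    using convex_on_dense_approx[OF g y _ Q(2,3), of "inverse (Suc n)"]
    by (metis inverse_positive_iff_positive of_nat_0_less_iff zero_less_Suc)
  then obtain q where q: "\<And>n. q n \<in> Q" "\<And>n. dist (q n) y < inverse (Suc n)"
      "\<And>n. g (q n) < g y + inverse (Suc n)" by metis
  have inv: "(\<lambda>n. inverse (real (Suc n))) \<longlonglongrightarrow> 0" by (rule LIMSEQ_inverse_real_of_nat)
  have "(\<lambda>n. dist (q n) y) \<longlonglongrightarrow> 0"
    using q(2) by (intro tendsto_sandwich[OF _ _ tendsto_const inv]) (auto intro: always_eventually less_imp_le)
  then have lim: "q \<longlonglongrightarrow> y" by (simp add: tendsto_dist_iff[of q])
  have c: "(\<lambda>n. h (q n)) \<longlonglongrightarrow> h y" if "continuous_on UNIV h" for h :: "'a \<Rightarrow> real"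
    using that lim by (metis UNIV_I continuous_on_eq_continuous_within continuous_within_tendsto_compose' tendsto_compose continuous_within)
  have "(\<lambda>n. fm x x \<xi> - Lt x \<xi> * sqrt (bregman \<omega> (q n) x) - e + \<rho> * (\<omega> (q n) - \<omega> y) - inverse (Suc n))
      \<longlonglongrightarrow> fm x x \<xi> - Lt x \<xi> * sqrt (bregman \<omega> y x) - e + \<rho> * (\<omega> y - \<omega> y) - 0"
    by (intro tendsto_intros inv c continuous_intros)
  moreover
  \<comment> \<open>The approximation only bounds the sum \<open>g (q n)\<close> from above. Lower
    semicontinuity keeps \<open>rr (q n)\<close> above \<open>rr y - e\<close>, which isolates an
    upper bound on the model value at \<open>q n\<close>.\<close>
  have "eventually (\<lambda>n. q n \<in> {z. ereal (rr y - e) < r z}) sequentially"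
    using lim r_lsc r_eq[OF y] e by (intro topological_tendstoD[OF lim]) (auto simp: lsc_def)
  then have "eventually (\<lambda>n. fm x x \<xi> - Lt x \<xi> * sqrt (bregman \<omega> (q n) x) - e + \<rho> * (\<omega> (q n) - \<omega> y)
      - inverse (Suc n) \<le> fm x y \<xi>) sequentially"
  proof eventually_elim
    case (elim n)
    have "q n \<in> dom_r" using q(1) Q_subset by blast
    then have "rr y - e < rr (q n)" using elim by (simp add: r_eq)
    moreover have "fm x x \<xi> - fm x (q n) \<xi> \<le> Lt x \<xi> * sqrt (bregman \<omega> (q n) x)"
      using q(1) by (rule le)
    ultimately show ?case using q(3)[of n] by (simp add: g_def algebra_simps)
  qed
  ultimately have "fm x x \<xi> - Lt x \<xi> * sqrt (bregman \<omega> y x) - e + \<rho> * (\<omega> y - \<omega> y) - 0 \<le> fm x y \<xi>"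
    by (intro tendsto_upperbound) auto
  then show "fm x x \<xi> - fm x y \<xi> \<le> Lt x \<xi> * sqrt (bregman \<omega> y x) + e" by simp
qed

end

section \<open>Proximal points and the Moreau envelope\<close>

locale prox_model = stochastic_model P fs r fm \<omega> \<tau> \<rho> Lt L
  for P :: "'o measure"
    and fs :: "'a::euclidean_space \<Rightarrow> 'o \<Rightarrow> real"
    and r fm \<omega> \<tau> \<rho> Lt L +
  fixes lam :: real
  assumes lam_pos: "0 < lam" and lam_less: "lam < 1 / (\<tau> + \<rho>)"
begin

definition prx where "prx x = prox \<omega> lam (objective P fs r) x"

definition env where "env x = real_of_ereal (moreau_env \<omega> lam (objective P fs r) x)"

text \<open>The modulus, relative to \<omega>, by which the proximal objective grows away from its
  minimizer; \<open>lam * mu\<close> is the factor 1 - \<lambda> (\<tau> + \<rho>) of the final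
  bound.\<close>

definition mu where "mu = 1 / lam - (\<tau> + \<rho>)"

lemma mu_pos: "mu > 0"
  using lam_pos lam_less tau_pos rho_pos by (simp add: mu_def field_simps)

lemma prox_exists:
  "\<exists>z\<in>dom_r. \<forall>y. objective P fs r z + ereal (1 / lam * bregman \<omega> z x)
    \<le> objective P fs r y + ereal (1 / lam * bregman \<omega> y x)"
proof -
  let ?\<phi> = "\<lambda>y. objective P fs r y + ereal (1 / lam * bregman \<omega> y x)"
  obtain x1 where x1: "x1 \<in> dom_r" using dom_r_nonempty by blast
  define V where "V = Fr x1 + 1 / lam * bregman \<omega> x1 x"
  \<comment> \<open>Beyond this radius, strong convexity of \<omega> makes the proximal term exceed
    \<open>V - Fmin\<close>, so the value at \<open>x1\<close> beats every point outside the
    ball.\<close>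
  define R where "R = sqrt (2 * lam * (V - Fmin))"
  have V: "?\<phi> x1 = ereal V" using x1 by (simp add: objective_eq V_def)
  have "Fmin \<le> V"
    using Fmin_le[OF x1] lam_pos unfolding V_def by (simp add: add_increasing2)
  then have R: "0 \<le> R" "R\<^sup>2 = 2 * lam * (V - Fmin)" using lam_pos by (auto simp: R_def)
  have far: "ereal V < ?\<phi> y" if "y \<notin> cball x R" for y
  proof (cases "y \<in> dom_r")
    case True
    have "R < norm (y - x)" using that by (simp add: dist_norm norm_minus_commute)
    then have "R\<^sup>2 < (norm (y - x))\<^sup>2" using R(1) by (intro power_strict_mono) auto
    then have "lam * (V - Fmin) < bregman \<omega> y x"
      using bregman_ge[of y x] unfolding R(2) by simp
    then have "V - Fmin < 1 / lam * bregman \<omega> y x" using lam_pos by (simp add: field_simps)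
    then show ?thesis using True Fmin_le[OF True] by (simp add: objective_eq)
  qed (simp add: objective_outside)
  have x1C: "x1 \<in> cball x R" using far[of x1] V by auto
  have "continuous_on UNIV (\<lambda>y. 1 / lam * bregman \<omega> y x)"
    by (intro continuous_intros)
  then have "lsc (\<lambda>y. ereal (1 / lam * bregman \<omega> y x))"
    unfolding lsc_def
    by (intro allI open_Collect_less continuous_on_const continuous_on_ereal)
  then have "lsc (\<lambda>y. ereal (1 / lam * bregman \<omega> y x) + objective P fs r y)"
    by (rule lsc_add[OF _ objective_lsc])
  then have "lsc ?\<phi>" by (simp only: add.commute)
  then obtain z where z: "z \<in> cball x R" "\<And>y. y \<in> cball x R \<Longrightarrow> ?\<phi> z \<le> ?\<phi> y"
    by (rule lsc_attains_inf_compact[OF _ compact_cball, of ?\<phi> x R]) (use x1C in blast)+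
  have zV: "?\<phi> z \<le> ereal V" using z(2)[OF x1C] V by simp
  have "z \<in> dom_r"
  proof (rule ccontr)
    assume "z \<notin> dom_r" then show False using zV by (simp add: objective_outside)
  qed
  moreover have "?\<phi> z \<le> ?\<phi> y" for y
    using z(2)[of y] far[of y] zV by (meson le_less_trans less_imp_le)
  ultimately show ?thesis by blast
qed

lemma prx_arg_min:
  "prx x \<in> dom_r"
  "objective P fs r (prx x) + ereal (1 / lam * bregman \<omega> (prx x) x)
    \<le> objective P fs r y + ereal (1 / lam * bregman \<omega> y x)"
proof -
  let ?\<phi> = "\<lambda>y. objective P fs r y + ereal (1 / lam * bregman \<omega> y x)"
  obtain z where z: "z \<in> dom_r" "\<And>y. ?\<phi> z \<le> ?\<phi> y" using prox_exists[of x] by blast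
  then have "is_arg_min ?\<phi> (\<lambda>_. True) (prx x)"
    unfolding prx_def prox_def arg_min_def
    by (intro someI[of "is_arg_min ?\<phi> (\<lambda>_. True)" z]) (simp add: is_arg_min_linorder)
  then have le: "?\<phi> (prx x) \<le> ?\<phi> y" for y by (simp add: is_arg_min_linorder)
  from le[of y] show "?\<phi> (prx x) \<le> ?\<phi> y" .
  show "prx x \<in> dom_r"
  proof (rule ccontr)
    assume "prx x \<notin> dom_r"
    then show False using le[of z] z(1) by (simp add: objective_outside objective_eq)
  qed
qed

lemma env_eq: "env x = Fr (prx x) + 1 / lam * bregman \<omega> (prx x) x"
proof -
  have "moreau_env \<omega> lam (objective P fs r) x
      = objective P fs r (prx x) + ereal (1 / lam * bregman \<omega> (prx x) x)"
    unfolding moreau_env_def using prx_arg_min(2)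
    by (intro antisym INF_lower2[of "prx x"] INF_greatest) auto
  then show ?thesis
    unfolding env_def by (simp add: objective_eq[OF prx_arg_min(1)])
qed

lemma env_le: "y \<in> dom_r \<Longrightarrow> env x \<le> Fr y + 1 / lam * bregman \<omega> y x"
  using prx_arg_min[of x] prx_arg_min(2)[of x y] by (simp add: objective_eq env_eq)

lemma Fmin_le_env: "Fmin \<le> env x"
  using Fmin_le[OF prx_arg_min(1)[of x]] lam_pos by (simp add: env_eq add_increasing2)

lemma prx_inequality:
  assumes "y \<in> dom_r"
  shows "env x + mu * bregman \<omega> y (prx x) \<le> Fr y + 1 / lam * bregman \<omega> y x"
  using prox_inequality[OF objective_weakly_convex prx_arg_min(1)[of x] assms, of "1 / lam" x]
    env_le[of _ x] by (simp add: env_eq mu_def)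

text \<open>Testing each proximal point in the inequality of the other and adding cancels the values
  of \<open>Fr\<close>; the four remaining distances combine to an inner product of the gradient
  difference with the displacement. The bound transfers continuity of \<open>grad \<omega>\<close>
  to \<open>prx\<close>, hence measurability.\<close>

lemma prx_lipschitz:
  "lam * mu * norm (prx x - prx y) \<le> norm (grad \<omega> x - grad \<omega> y)"
proof -
  let ?u = "prx x" and ?v = "prx y"
  have 1: "env x + mu * bregman \<omega> ?v ?u \<le> Fr ?v + 1 / lam * bregman \<omega> ?v x"
    by (intro prx_inequality prx_arg_min)
  have 2: "env y + mu * bregman \<omega> ?u ?v \<le> Fr ?u + 1 / lam * bregman \<omega> ?u y"
    by (intro prx_inequality prx_arg_min)
  have B: "bregman \<omega> ?v x + bregman \<omega> ?u y - bregman \<omega> ?u x - bregman \<omega> ?v y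
      = (grad \<omega> x - grad \<omega> y) \<bullet> (?u - ?v)"
    by (simp add: bregman_def inner_diff_left inner_diff_right)
  have "mu * (bregman \<omega> ?v ?u + bregman \<omega> ?u ?v)
      \<le> 1 / lam * (bregman \<omega> ?v x + bregman \<omega> ?u y - bregman \<omega> ?u x - bregman \<omega> ?v y)"
    using 1 2 unfolding env_eq by (simp add: algebra_simps)
  also have "\<dots> \<le> 1 / lam * (norm (grad \<omega> x - grad \<omega> y) * norm (?u - ?v))"
    unfolding B using lam_pos norm_cauchy_schwarz by (intro mult_left_mono) auto
  finally have "lam * mu * (bregman \<omega> ?v ?u + bregman \<omega> ?u ?v)
      \<le> norm (grad \<omega> x - grad \<omega> y) * norm (?u - ?v)"
    using lam_pos by (simp add: field_simps)
  moreover have "(norm (?u - ?v))\<^sup>2 \<le> bregman \<omega> ?v ?u + bregman \<omega> ?u ?v"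
    using bregman_ge[of ?u ?v] bregman_ge[of ?v ?u] by (simp add: norm_minus_commute)
  then have "lam * mu * (norm (?u - ?v))\<^sup>2 \<le> lam * mu * (bregman \<omega> ?v ?u + bregman \<omega> ?u ?v)"
    using lam_pos mu_pos by (intro mult_left_mono) auto
  ultimately have "(lam * mu * norm (?u - ?v)) * norm (?u - ?v)
      \<le> norm (grad \<omega> x - grad \<omega> y) * norm (?u - ?v)"
    by (simp add: power2_eq_square mult.assoc)
  then show ?thesis
    by (cases "norm (?u - ?v) = 0") (auto simp: mult_le_cancel_right)
qed

lemma continuous_on_prx: "continuous_on UNIV prx"
proof -
  have "(prx \<longlongrightarrow> prx x) (at x)" for x
  proof (subst tendsto_dist_iff)
    have g: "(grad \<omega> \<longlongrightarrow> grad \<omega> x) (at x)"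
      using continuous_on_grad[of UNIV] by (simp add: continuous_on_eq_continuous_at isCont_def)
    have "((\<lambda>y. norm (grad \<omega> y - grad \<omega> x) / (lam * mu)) \<longlongrightarrow> norm (grad \<omega> x - grad \<omega> x) / (lam * mu)) (at x)"
      using lam_pos mu_pos by (intro tendsto_intros g) auto
    then have lim: "((\<lambda>y. norm (grad \<omega> y - grad \<omega> x) / (lam * mu)) \<longlongrightarrow> 0) (at x)" by simp
    have "dist (prx y) (prx x) \<le> norm (grad \<omega> y - grad \<omega> x) / (lam * mu)" for y
      using prx_lipschitz[of y x] lam_pos mu_pos by (simp add: dist_norm field_simps)
    then show "((\<lambda>y. dist (prx y) (prx x)) \<longlongrightarrow> 0) (at x)"
      by (intro tendsto_sandwich[OF _ _ tendsto_const lim]) auto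
  qed
  then show ?thesis by (simp add: continuous_on_eq_continuous_at isCont_def)
qed

lemma prx_measurable [measurable]: "prx \<in> borel_measurable borel"
  using continuous_on_prx by (rule borel_measurable_continuous_onI)

end

section \<open>The model step\<close>

context stochastic_model
begin

text \<open>The values of \<open>subproblem\<close> are meaningful on \<open>dom_r\<close> only, since \<open>rr\<close> is \<open>0\<close> where \<open>r\<close> is infinite.\<close>

definition subproblem :: "real \<Rightarrow> 'a \<Rightarrow> 'o \<Rightarrow> 'a \<Rightarrow> real" where
  "subproblem t x \<xi> y = fm x y \<xi> + rr y + 1 / t * bregman \<omega> y x"

definition model_arg_min :: "real \<Rightarrow> 'a \<Rightarrow> 'o \<Rightarrow> 'a \<Rightarrow> bool" where
  "model_arg_min t x \<xi> z \<longleftrightarrow>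
     is_arg_min (\<lambda>y. ereal (fm x y \<xi>) + r y + ereal (1 / t * bregman \<omega> y x)) (\<lambda>_. True) z"

lemma model_arg_minD:
  assumes "model_arg_min t x \<xi> z"
  shows "z \<in> dom_r" and "y \<in> dom_r \<Longrightarrow> subproblem t x \<xi> z \<le> subproblem t x \<xi> y"
proof -
  have le: "ereal (fm x z \<xi>) + r z + ereal (1 / t * bregman \<omega> z x)
      \<le> ereal (fm x y \<xi>) + r y + ereal (1 / t * bregman \<omega> y x)" for y
    using assms by (simp add: model_arg_min_def is_arg_min_linorder)
  show z: "z \<in> dom_r"
  proof (rule ccontr)
    assume "z \<notin> dom_r"
    moreover obtain y where "y \<in> dom_r" using dom_r_nonempty by blast
    ultimately show False using le[of y] by (simp add: r_eq r_outside)
  qed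
  show "subproblem t x \<xi> z \<le> subproblem t x \<xi> y" if "y \<in> dom_r"
    using le[of y] z that by (simp add: subproblem_def r_eq)
qed

lemma model_arg_min_inequality:
  assumes "\<xi> \<in> space P" "model_arg_min t x \<xi> z" "y \<in> dom_r"
  shows "subproblem t x \<xi> z + (1 / t - \<rho>) * bregman \<omega> y z \<le> subproblem t x \<xi> y"
  using prox_inequality[OF model_convex[OF assms(1), of x] model_arg_minD(1)[OF assms(2)] assms(3), of "1 / t" x]
    model_arg_minD(2)[OF assms(2)] by (simp add: subproblem_def)

text \<open>The subproblem is the weakly convex model made convex by
  \<open>\<rho> * \<omega> y\<close>, plus the continuous remainder \<open>h\<close>, so points of
  \<open>Q\<close> come close to its value at every point of the domain.\<close>

lemma subproblem_Q_approx:
  assumes \<xi>: "\<xi> \<in> space P" and z: "z \<in> dom_r" and e: "0 < e"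
  obtains q where "q \<in> Q" "subproblem t x \<xi> q < subproblem t x \<xi> z + e"
proof -
  define h where "h y = 1 / t * bregman \<omega> y x - \<rho> * \<omega> y" for y
  have "continuous_on UNIV h"
    unfolding h_def by (intro continuous_intros)
  then obtain d where d: "0 < d" "\<And>y. dist y z < d \<Longrightarrow> dist (h y) (h z) < e / 2"
    using e unfolding continuous_on_iff by (metis UNIV_I half_gt_zero)
  have e2: "0 < min d (e / 2)" using d(1) e by simp
  obtain q where q: "q \<in> Q" "dist q z < min d (e / 2)"
    "fm x q \<xi> + rr q + \<rho> * \<omega> q < fm x z \<xi> + rr z + \<rho> * \<omega> z + min d (e / 2)"
    using convex_on_dense_approx[OF model_convex[OF \<xi>, of x] z e2 Q(2,3)] by blast
  have "h q < h z + e / 2" using d(2)[of q] q(2) abs_ge_self[of "h q - h z"] by (simp add: dist_real_def)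
  then have "subproblem t x \<xi> q < subproblem t x \<xi> z + e"
    using q(3) by (simp add: subproblem_def h_def)
  with q(1) show thesis by (rule that)
qed

text \<open>
  A measurable version of the argmin: the limit of the first \<open>1/(n+1)\<close>-minimizers in an enumeration
  of the countable set \<open>Q\<close>. Strong convexity makes near-minimizers converge.
\<close>

definition near_min :: "real \<Rightarrow> nat \<Rightarrow> 'a \<Rightarrow> 'o \<Rightarrow> 'a" where
  "near_min t n x \<xi> = from_nat_into Q (LEAST i. ereal (subproblem t x \<xi> (from_nat_into Q i))
      < (INF j. ereal (subproblem t x \<xi> (from_nat_into Q j))) + ereal (inverse (Suc n)))"

definition model_step :: "real \<Rightarrow> 'a \<Rightarrow> 'o \<Rightarrow> 'a" where
  "model_step t x \<xi> = lim (\<lambda>n. near_min t n x \<xi>)"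

text \<open>The infimum over \<open>Q\<close> equals the value at \<open>z\<close>, so the n-th
  near-minimizer lies within squared distance 2 / ((1/t - \<rho>) (n + 1)) of \<open>z\<close>.
  Hence whichever minimizer a run provides, it coincides with the measurable limit.\<close>

lemma model_step_eq:
  assumes \<xi>: "\<xi> \<in> space P" and z: "model_arg_min t x \<xi> z" and t: "0 < t" "t * \<rho> < 1"
  shows "model_step t x \<xi> = z"
proof -
  let ?q = "from_nat_into Q"
  have q: "?q i \<in> dom_r" for i
    using from_nat_into[OF Q_nonempty, of i] Q_subset by blast
  have zd: "z \<in> dom_r" using z by (rule model_arg_minD)
  have near: "\<exists>i. subproblem t x \<xi> (?q i) < subproblem t x \<xi> z + e" if "e > 0" for e
    using subproblem_Q_approx[OF \<xi> zd that, of t x] from_nat_into_surj[OF Q(1)] by metis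
  have inf: "(INF i. ereal (subproblem t x \<xi> (?q i))) = ereal (subproblem t x \<xi> z)"
  proof (rule antisym)
    show "ereal (subproblem t x \<xi> z) \<le> (INF i. ereal (subproblem t x \<xi> (?q i)))"
      using model_arg_minD(2)[OF z q] by (intro INF_greatest) simp
    show "(INF i. ereal (subproblem t x \<xi> (?q i))) \<le> ereal (subproblem t x \<xi> z)"
    proof (rule ereal_le_epsilon2)
      fix e :: real assume "0 < e"
      then obtain i where "subproblem t x \<xi> (?q i) < subproblem t x \<xi> z + e" using near by blast
      then show "(INF i. ereal (subproblem t x \<xi> (?q i))) \<le> ereal (subproblem t x \<xi> z) + ereal e"
        by (intro INF_lower2[of i]) auto
    qed
  qed
  have c: "0 < 1 / t - \<rho>" using t by (simp add: field_simps)
  have close: "(norm (near_min t n x \<xi> - z))\<^sup>2 \<le> 2 / (1 / t - \<rho>) * inverse (Suc n)" for n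
  proof -
    let ?y = "near_min t n x \<xi>"
    obtain i where "subproblem t x \<xi> (?q i) < subproblem t x \<xi> z + inverse (Suc n)"
      using near[of "inverse (Suc n)"] by auto
    then have "subproblem t x \<xi> ?y < subproblem t x \<xi> z + inverse (Suc n)"
      unfolding near_min_def inf by (simp only: plus_ereal.simps less_ereal.simps) (rule LeastI)
    moreover have "?y \<in> dom_r" unfolding near_min_def by (rule q)
    note model_arg_min_inequality[OF \<xi> z this]
    ultimately have "(1 / t - \<rho>) * bregman \<omega> ?y z \<le> inverse (Suc n)" by simp
    moreover have "(1 / t - \<rho>) * ((norm (?y - z))\<^sup>2 / 2) \<le> (1 / t - \<rho>) * bregman \<omega> ?y z"
      using c bregman_ge by (intro mult_left_mono) auto
    ultimately have "(1 / t - \<rho>) * ((norm (?y - z))\<^sup>2 / 2) \<le> inverse (Suc n)"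
      by (rule order_trans[rotated])
    then show ?thesis using c by (simp add: pos_le_divide_eq mult.commute)
  qed
  have "(\<lambda>n. 2 / (1 / t - \<rho>) * inverse (Suc n)) \<longlonglongrightarrow> 2 / (1 / t - \<rho>) * 0"
    by (intro tendsto_intros LIMSEQ_inverse_real_of_nat)
  then have lim: "(\<lambda>n. 2 / (1 / t - \<rho>) * inverse (Suc n)) \<longlonglongrightarrow> 0" by simp
  have "(\<lambda>n. (norm (near_min t n x \<xi> - z))\<^sup>2) \<longlonglongrightarrow> 0"
    by (rule tendsto_sandwich[OF _ _ tendsto_const lim]) (use close in \<open>auto intro!: always_eventually\<close>)
  then have "(\<lambda>n. sqrt ((norm (near_min t n x \<xi> - z))\<^sup>2)) \<longlonglongrightarrow> sqrt 0"
    by (rule tendsto_real_sqrt)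
  then have "(\<lambda>n. near_min t n x \<xi>) \<longlonglongrightarrow> z"
    by (simp add: LIM_zero_iff tendsto_norm_zero_iff)
  then show ?thesis unfolding model_step_def by (rule limI)
qed

lemma fm_measurable_comp [measurable (raw)]:
  assumes "g \<in> borel_measurable N" "h \<in> borel_measurable N" "k \<in> measurable N P"
  shows "(\<lambda>w. fm (g w) (h w) (k w)) \<in> borel_measurable N"
proof -
  have "(\<lambda>w. (g w, h w, k w)) \<in> measurable N (borel \<Otimes>\<^sub>M borel \<Otimes>\<^sub>M P)"
    using assms by measurable
  from measurable_compose[OF this model_measurable] show ?thesis by simp
qed

lemma Lt_measurable_comp [measurable (raw)]:
  assumes "g \<in> borel_measurable N" "k \<in> measurable N P"
  shows "(\<lambda>w. Lt (g w) (k w)) \<in> borel_measurable N"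
proof -
  have "(\<lambda>w. (g w, k w)) \<in> measurable N (borel \<Otimes>\<^sub>M P)"
    using assms by measurable
  from measurable_compose[OF this Lt_measurable] show ?thesis by simp
qed

lemma bregman_measurable_comp [measurable (raw)]:
  assumes [measurable]: "g \<in> borel_measurable N" "h \<in> borel_measurable N"
  shows "(\<lambda>w. bregman \<omega> (g w) (h w)) \<in> borel_measurable N"
proof -
  have [measurable]: "\<omega> \<in> borel_measurable borel" "grad \<omega> \<in> borel_measurable borel"
    using continuous_on_omega continuous_on_grad by (auto intro: borel_measurable_continuous_onI)
  show ?thesis unfolding bregman_def by measurable
qed

text \<open>The infimum and the least index run over an enumeration of \<open>Q\<close>, so only
  countable operations and a pointwise limit are involved.\<close>

lemma model_step_measurable [measurable (raw)]:
  assumes [measurable]: "g \<in> borel_measurable N" "k \<in> measurable N P"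
  shows "(\<lambda>w. model_step t (g w) (k w)) \<in> borel_measurable N"
proof -
  have [measurable]: "(\<lambda>w. subproblem t (g w) (k w) y) \<in> borel_measurable N" for y
    unfolding subproblem_def by measurable
  have [measurable]: "(\<lambda>i. from_nat_into Q i) \<in> measurable (count_space UNIV) borel"
    by simp
  have "(\<lambda>w. near_min t n (g w) (k w)) \<in> borel_measurable N" for n
    unfolding near_min_def by measurable
  then show ?thesis
    unfolding model_step_def by (rule borel_measurable_lim_metric)
qed

end

section \<open>One-step descent and the sampling error\<close>

context prox_model
begin

text \<open>Sampling error in the increment of the loss from \<open>x\<close> to its proximal point.
  At \<open>x\<close> the model is unbiased, so the mean only sees the one-sided accuracy at
  \<open>prx x\<close>.\<close>

definition deviation :: "'a \<Rightarrow> 'o \<Rightarrow> real" where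
  "deviation x \<xi> = fm x (prx x) \<xi> - fm x x \<xi> - (f (prx x) - f x)"

text \<open>The minimality inequality contains the model at \<open>z\<close>, while the potential
  needs the true loss there. The Lipschitz condition of the current model leads from
  \<open>z\<close> back to \<open>x\<close>, and \<open>loss_diff_le_bregman\<close> from the loss
  at \<open>x\<close> to the loss at \<open>z\<close>. Both cost a multiple of \<open>s\<close>,
  which the proximal term of \<open>z\<close> absorbs by Young's inequality.\<close>

lemma step_pathwise:
  assumes \<xi>: "\<xi> \<in> space P" and z: "model_arg_min t x \<xi> z"
    and t: "0 < t" "t * \<rho> < 1" "t * \<tau> < 1"
    and lip: "\<And>q. q \<in> Q \<Longrightarrow> fm x x \<xi> - fm x q \<xi> \<le> Lt x \<xi> * sqrt (bregman \<omega> q x)"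
  shows "(env z - Fmin) + t / (1 - t * \<rho>) / lam * (Fr z - Fmin)
    \<le> (Fr (prx x) - Fmin)
      + t / (1 - t * \<rho>) / lam * (deviation x \<xi> + (Fr (prx x) - Fmin) + 1 / t * bregman \<omega> (prx x) x)
      + t\<^sup>2 / ((1 - t * \<rho>) * (1 - t * \<tau>)) / (2 * lam) * ((Lt x \<xi>)\<^sup>2 + lip2 z)"
proof -
  define p where "p = prx x"
  define s where "s = sqrt (bregman \<omega> z x)"
  \<comment> \<open>Scales the inequality so that \<open>bregman \<omega> p z\<close> has
    coefficient 1, as \<open>env_le\<close> requires after division by \<open>lam\<close>.\<close>
  define a where "a = t / (1 - t * \<rho>)"
  have p: "p \<in> dom_r" unfolding p_def by (rule prx_arg_min)
  have zd: "z \<in> dom_r" using z by (rule model_arg_minD)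
  have s2: "bregman \<omega> z x = s\<^sup>2" by (simp add: s_def)
  have c: "0 < 1 / t - \<tau>" using t by (simp add: field_simps)
  have a: "0 < a" "a * (1 / t - \<rho>) = 1" using t by (auto simp: a_def field_simps)
  have 1: "subproblem t x \<xi> z + (1 / t - \<rho>) * bregman \<omega> p z \<le> subproblem t x \<xi> p"
    using \<xi> z p by (rule model_arg_min_inequality)
  have 2: "fm x x \<xi> - fm x z \<xi> \<le> Lt x \<xi> * s"
    unfolding s_def using lipschitz_from_Q[OF \<xi> zd lip] by blast
  \<comment> \<open>Based at the new point, hence \<open>lip2 z\<close>; the extra
    \<open>\<tau> * s\<^sup>2\<close> lowers the available quadratic from 1/t to 1/t -
    \<tau>.\<close>
  have 3: "f z - f x \<le> sqrt (lip2 z) * s + \<tau> * s\<^sup>2"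
    using loss_diff_le_bregman(1)[of z x] by (simp add: s_def)
  have 4: "(Lt x \<xi> + sqrt (lip2 z)) * s - (1 / t - \<tau>) * s\<^sup>2 \<le> ((Lt x \<xi>)\<^sup>2 + lip2 z) / (2 * (1 / t - \<tau>))"
    using young_quadratic[OF c, of "Lt x \<xi>" "sqrt (lip2 z)" s] lip2_nonneg[of z] by simp
  have "(1 / t - \<rho>) * bregman \<omega> p z + (Fr z - Fmin)
      \<le> deviation x \<xi> + (Fr p - Fmin) + 1 / t * bregman \<omega> p x + ((Lt x \<xi>)\<^sup>2 + lip2 z) / (2 * (1 / t - \<tau>))"
  proof -
    define w B C Y where "w = 1 / t * s\<^sup>2" and "B = (1 / t - \<rho>) * bregman \<omega> p z"
      and "C = 1 / t * bregman \<omega> p x" and "Y = ((Lt x \<xi>)\<^sup>2 + lip2 z) / (2 * (1 / t - \<tau>))"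
    have "Lt x \<xi> * s + sqrt (lip2 z) * s + \<tau> * s\<^sup>2 - w \<le> Y"
      using 4 unfolding w_def Y_def by (simp only: left_diff_distrib distrib_right)
    moreover have "fm x z \<xi> + rr z + w + B \<le> fm x p \<xi> + rr p + C"
      using 1 unfolding subproblem_def s2 w_def B_def C_def .
    ultimately have "B + (Fr z - Fmin) \<le> deviation x \<xi> + (Fr p - Fmin) + C + Y"
      using 2 3 unfolding deviation_def p_def[symmetric] Fr_def by linarith
    then show ?thesis unfolding B_def C_def Y_def .
  qed
  then have "a * ((1 / t - \<rho>) * bregman \<omega> p z + (Fr z - Fmin))
      \<le> a * (deviation x \<xi> + (Fr p - Fmin) + 1 / t * bregman \<omega> p x + ((Lt x \<xi>)\<^sup>2 + lip2 z) / (2 * (1 / t - \<tau>)))"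
    using a(1) by (intro mult_left_mono) auto
  also have "\<dots> = a * (deviation x \<xi> + (Fr p - Fmin) + 1 / t * bregman \<omega> p x)
      + a / (2 * (1 / t - \<tau>)) * ((Lt x \<xi>)\<^sup>2 + lip2 z)"
    by (simp add: distrib_left add_divide_distrib)
  also have "a / (2 * (1 / t - \<tau>)) = t\<^sup>2 / ((1 - t * \<rho>) * (1 - t * \<tau>)) / 2"
    using t c by (simp add: a_def field_simps power2_eq_square)
  finally have "a * (1 / t - \<rho>) * bregman \<omega> p z + a * (Fr z - Fmin)
      \<le> a * (deviation x \<xi> + (Fr p - Fmin) + 1 / t * bregman \<omega> p x)
      + t\<^sup>2 / ((1 - t * \<rho>) * (1 - t * \<tau>)) / 2 * ((Lt x \<xi>)\<^sup>2 + lip2 z)"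
    by (simp only: distrib_left mult.assoc)
  then have "1 / lam * (bregman \<omega> p z + a * (Fr z - Fmin))
      \<le> 1 / lam * (a * (deviation x \<xi> + (Fr p - Fmin) + 1 / t * bregman \<omega> p x)
      + t\<^sup>2 / ((1 - t * \<rho>) * (1 - t * \<tau>)) / 2 * ((Lt x \<xi>)\<^sup>2 + lip2 z))"
    unfolding a(2) using lam_pos by (intro mult_left_mono) auto
  also have "\<dots> = a / lam * (deviation x \<xi> + (Fr p - Fmin) + 1 / t * bregman \<omega> p x)
      + t\<^sup>2 / ((1 - t * \<rho>) * (1 - t * \<tau>)) / (2 * lam) * ((Lt x \<xi>)\<^sup>2 + lip2 z)"
    by (simp only: distrib_left times_divide_times_eq divide_divide_eq_left times_divide_eq_left mult_1_left
        mult.assoc mult.commute[of lam])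
  finally have "1 / lam * bregman \<omega> p z + a / lam * (Fr z - Fmin)
      \<le> a / lam * (deviation x \<xi> + (Fr p - Fmin) + 1 / t * bregman \<omega> p x)
      + t\<^sup>2 / ((1 - t * \<rho>) * (1 - t * \<tau>)) / (2 * lam) * ((Lt x \<xi>)\<^sup>2 + lip2 z)"
    by (simp add: distrib_left)
  moreover have "env z \<le> Fr p + 1 / lam * bregman \<omega> p z" using p by (rule env_le)
  ultimately show ?thesis unfolding p_def[symmetric] a_def[symmetric] by linarith
qed

text \<open>With D = D(p, x), the value at \<open>prx x\<close> is the envelope minus D / \<lambda>,
  and the proximal term returns a / t times D / \<lambda>. Since
  \<open>a / t = 1 + a * \<rho>\<close>, the unit part cancels and the rest leaves a multiple -a mu
  / \<lambda> of D. The inequality for \<open>prx x\<close> tested at \<open>x\<close> supplies the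
  same multiple of the reversed distance.\<close>

lemma step_drift:
  assumes x: "x \<in> dom_r" and t: "0 < t" "t * \<rho> < 1"
  shows "(Fr (prx x) - Fmin)
      + t / (1 - t * \<rho>) / lam * (\<tau> * bregman \<omega> (prx x) x + (Fr (prx x) - Fmin) + 1 / t * bregman \<omega> (prx x) x)
    \<le> (env x - Fmin) + t / (1 - t * \<rho>) / lam * (Fr x - Fmin)
      - (1 - lam * (\<tau> + \<rho>)) * (t * bregman_sym \<omega> lam (prx x) x)"
proof -
  define p where "p = prx x"
  define a where "a = t / (1 - t * \<rho>)"
  define D where "D = bregman \<omega> p x"
  define D' where "D' = bregman \<omega> x p"
  have D: "0 \<le> D" "0 \<le> D'" by (simp_all add: D_def D'_def)
  have a: "0 < a" "a / t = 1 + a * \<rho>" using t by (auto simp: a_def field_simps)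
  \<comment> \<open>Only \<open>t\<close> of the available weight \<open>a\<close> is kept on the
    symmetric distance, matching the probabilities of the random index.\<close>
  have "t * 1 \<le> t * (1 / (1 - t * \<rho>))"
    using t rho_pos by (intro mult_left_mono) auto
  then have at: "t \<le> a" by (simp add: a_def)
  have "env x + mu * D' \<le> Fr x"
    using prx_inequality[OF x, of x] by (simp add: p_def D'_def)
  then have "a / lam * (env x + mu * D') \<le> a / lam * Fr x"
    using a lam_pos by (intro mult_left_mono) auto
  moreover have Frp: "Fr p = env x - D / lam" by (simp add: env_eq p_def D_def)
  have "(Fr p - Fmin) + a / lam * (\<tau> * D + (Fr p - Fmin) + 1 / t * D)
      = (env x - Fmin) - D / lam + a / lam * (env x - Fmin) + a / lam * (\<tau> * D - D / lam) + a / t * D / lam"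
    unfolding Frp by (simp add: algebra_simps)
  moreover have "\<dots> = (env x - Fmin) + a / lam * (env x - Fmin) - a / lam * mu * D"
    unfolding a(2) mu_def by (simp add: field_simps add_divide_distrib diff_divide_distrib)
  moreover have "t * (mu / lam * (D + D')) \<le> a * (mu / lam * (D + D'))"
    using at D mu_pos lam_pos by (intro mult_right_mono) auto
  moreover have "a * (mu / lam * (D + D')) = a / lam * mu * D + a / lam * (mu * D')"
    by (simp add: distrib_left)
  moreover have "a / lam * (env x + mu * D') = a / lam * (env x - Fmin) + a / lam * Fmin + a / lam * (mu * D')"
    "a / lam * Fr x = a / lam * (Fr x - Fmin) + a / lam * Fmin"
    by (simp_all add: distrib_left right_diff_distrib add_divide_distrib diff_divide_distrib)
  moreover have "(1 - lam * (\<tau> + \<rho>)) * (t * bregman_sym \<omega> lam p x) = t * (mu / lam * (D + D'))"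
    using lam_pos by (simp add: bregman_sym_def mu_def D_def D'_def field_simps power2_eq_square)
  ultimately show ?thesis
    unfolding p_def[symmetric] a_def[symmetric] D_def[symmetric] by argo
qed

lemma gap_prx_le: "Fr (prx x) - Fmin + bregman \<omega> (prx x) x / lam = env x - Fmin"
  by (simp add: env_eq)

lemma bregman_prx_le: "bregman \<omega> (prx x) x \<le> lam * (env x - Fmin)"
proof -
  have "bregman \<omega> (prx x) x / lam \<le> env x - Fmin"
    using gap_prx_le[of x] Fmin_le[OF prx_arg_min(1)[of x]] by simp
  then show ?thesis using lam_pos by (simp add: field_simps)
qed

lemma env_le_Fr: "x \<in> dom_r \<Longrightarrow> env x \<le> Fr x"
  using env_le[of x x] by simp

lemma env_measurable [measurable]: "env \<in> borel_measurable borel"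
  unfolding env_eq[abs_def] by measurable

lemma bregman_sym_prx_nonneg: "0 \<le> bregman_sym \<omega> lam u x"
  by (simp add: bregman_sym_def)

lemma bregman_sym_prx_measurable [measurable]:
  "(\<lambda>x. bregman_sym \<omega> lam (prx x) x) \<in> borel_measurable borel"
  unfolding bregman_sym_def by measurable

lemma deviation_integrable: "integrable P (deviation x)"
  unfolding deviation_def[abs_def] by (simp add: model_integrable)

lemma expectation_deviation_le: "(\<integral>\<xi>. deviation x \<xi> \<partial>P) \<le> \<tau> * bregman \<omega> (prx x) x"
proof -
  have "(\<integral>\<xi>. deviation x \<xi> \<partial>P) = (\<integral>\<xi>. fm x (prx x) \<xi> - f (prx x) \<partial>P)"
    by (simp add: deviation_def model_integrable unbiased prob_space)
  also have "\<dots> \<le> \<tau> * min (bregman \<omega> x (prx x)) (bregman \<omega> (prx x) x)" by (rule accuracy)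
  also have "\<dots> \<le> \<tau> * bregman \<omega> (prx x) x" using tau_pos by (intro mult_left_mono) auto
  finally show ?thesis .
qed

text \<open>Needed for Fubini. The model increment is only bounded from below, so its absolute value
  is estimated by the signed value plus twice that bound, and accuracy controls the mean of the
  signed value. All terms become affine in the envelope gap, which is integrable along the
  run.\<close>

lemma expectation_abs_deviation_le:
  assumes bound: "\<And>x. lip2 x \<le> \<alpha> * (env x - Fmin) + \<beta>" and \<alpha>: "0 \<le> \<alpha>"
  shows "(\<integral>\<xi>. \<bar>deviation x \<xi>\<bar> \<partial>P) \<le> (2 * \<alpha> + 3 * \<tau> * lam + 2 * lam) * (env x - Fmin) + 2 * \<beta>"
proof -
  define p where "p = prx x"
  define D where "D = bregman \<omega> p x"
  define A where "A = \<alpha> * (env x - Fmin)"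
  have D0: "0 \<le> D" by (simp add: D_def)
  have D: "D \<le> lam * (env x - Fmin)" using bregman_prx_le by (simp add: D_def p_def)
  \<comment> \<open>The envelope does not increase at the proximal point, by
    \<open>env p \<le> Fr p \<le> env x\<close>; this expresses the growth bound at \<open>p\<close>
    through the envelope at \<open>x\<close>.\<close>
  have "env p - Fmin \<le> env x - Fmin"
  proof -
    have "0 \<le> D / lam" using D0 lam_pos by simp
    then show ?thesis
      using env_le_Fr[OF prx_arg_min(1)[of x]] gap_prx_le[of x] unfolding p_def D_def by linarith
  qed
  then have "\<alpha> * (env p - Fmin) \<le> A" unfolding A_def using \<alpha> by (rule mult_left_mono)
  then have lp: "lip2 p \<le> A + \<beta>" using bound[of p] by linarith
  have "f p - f x \<le> sqrt (lip2 p) * sqrt D + \<tau> * D"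
    using loss_diff_le_bregman(1)[of p x] by (simp add: D_def)
  then have up: "f p - f x \<le> (A + \<beta> + D) / 2 + \<tau> * D"
    using sqrt_mult_le_half[OF lip2_nonneg D0, of p] lp by argo
  have lx: "sqrt (lip2 x) * sqrt D \<le> (A + \<beta> + D) / 2"
    using sqrt_mult_le_half[OF lip2_nonneg D0, of x] bound[of x] by (simp add: A_def)
  have "f x - f p \<le> sqrt (lip2 x) * sqrt D + \<tau> * D"
    using loss_diff_le_bregman(2)[of x p] by (simp add: D_def)
  then have abs: "\<bar>f p - f x\<bar> \<le> (A + \<beta> + D) / 2 + \<tau> * D"
    using up lx by argo
  have "AE \<xi> in P. fm x x \<xi> - fm x p \<xi> \<le> Lt x \<xi> * sqrt (min (bregman \<omega> x p) D)"
    using lipschitz[of x p] by (simp add: D_def)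
  then have ae: "AE \<xi> in P. \<bar>deviation x \<xi>\<bar> \<le> deviation x \<xi> + (2 * (Lt x \<xi> * sqrt D) + 2 * \<bar>f p - f x\<bar>)"
    using AE_space
  proof eventually_elim
    case (elim \<xi>)
    have Lt: "0 \<le> Lt x \<xi>" using elim(2) by (rule Lt_nonneg)
    then have "Lt x \<xi> * sqrt (min (bregman \<omega> x p) D) \<le> Lt x \<xi> * sqrt D"
      by (intro mult_left_mono) auto
    moreover have "0 \<le> Lt x \<xi> * sqrt D" using Lt D0 by simp
    moreover have "\<bar>u - v\<bar> \<le> u - v + (2 * w + 2 * \<bar>v\<bar>)" if "- w \<le> u" "0 \<le> w" for u v w :: real
      using that by linarith
    ultimately show ?case
      using elim(1) unfolding deviation_def p_def[symmetric] by simp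
  qed
  have "(\<integral>\<xi>. \<bar>deviation x \<xi>\<bar> \<partial>P) \<le> (\<integral>\<xi>. deviation x \<xi> + (2 * (Lt x \<xi> * sqrt D) + 2 * \<bar>f p - f x\<bar>) \<partial>P)"
    using ae by (intro integral_mono_AE Bochner_Integration.integrable_add integrable_abs deviation_integrable
        Bochner_Integration.integrable_mult_right Bochner_Integration.integrable_mult_left Lt_integrable integrable_const)
  also have "\<dots> = (\<integral>\<xi>. deviation x \<xi> \<partial>P) + (2 * ((\<integral>\<xi>. Lt x \<xi> \<partial>P) * sqrt D) + 2 * \<bar>f p - f x\<bar>)"
    by (simp add: deviation_integrable Lt_integrable prob_space)
  also have "\<dots> \<le> \<tau> * D + (2 * (sqrt (lip2 x) * sqrt D) + 2 * \<bar>f p - f x\<bar>)"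
    using expectation_deviation_le[of x] expectation_Lt_le[of x] D0
    by (intro add_mono mult_left_mono mult_right_mono) (auto simp: D_def p_def)
  also have "\<dots> \<le> \<tau> * D + ((A + \<beta> + D) + (A + \<beta> + D + 2 * \<tau> * D))"
  proof -
    have "2 * (sqrt (lip2 x) * sqrt D) \<le> A + \<beta> + D"
      "2 * \<bar>f p - f x\<bar> \<le> A + \<beta> + D + 2 * \<tau> * D"
      using mult_left_mono[OF lx, of 2] mult_left_mono[OF abs, of 2]
      by (simp_all add: distrib_left add_divide_distrib mult.assoc)
    then show ?thesis by (intro add_mono) auto
  qed
  also have "\<dots> = 2 * A + (3 * \<tau> + 2) * D + 2 * \<beta>"
    by (simp add: algebra_simps)
  also have "(3 * \<tau> + 2) * D \<le> (3 * \<tau> + 2) * (lam * (env x - Fmin))"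
    using D tau_pos by (intro mult_left_mono) auto
  finally show ?thesis by (simp add: A_def algebra_simps)
qed

end

section \<open>Random iterates\<close>

lemma (in prob_space) indep_set_mono:
  "indep_set A B \<Longrightarrow> A' \<subseteq> A \<Longrightarrow> B' \<subseteq> B \<Longrightarrow> indep_set A' B'"
  unfolding indep_set_def by (erule indep_sets_mono_sets) (auto split: bool.split)

lemma integrable_nonneg_bound:
  fixes g h :: "'a \<Rightarrow> real"
  assumes "integrable M h" "g \<in> borel_measurable M" "AE x in M. 0 \<le> g x" "AE x in M. g x \<le> h x"
  shows "integrable M g"
proof (rule Bochner_Integration.integrable_bound[OF assms(1,2)])
  show "AE x in M. norm (g x) \<le> norm (h x)"
    using assms(3,4) by eventually_elim simp
qed

locale model_run = prox_model P fs r fm \<omega> \<tau> \<rho> Lt L lam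
  for P :: "'o measure"
    and fs :: "'a::euclidean_space \<Rightarrow> 'o \<Rightarrow> real"
    and r fm \<omega> \<tau> \<rho> Lt L lam +
  fixes M :: "'w measure" and t :: "nat \<Rightarrow> real" and K :: nat and x0 :: 'a
    and \<xi> :: "nat \<Rightarrow> 'w \<Rightarrow> 'o" and X :: "nat \<Rightarrow> 'w \<Rightarrow> 'a" and kb :: "'w \<Rightarrow> nat"
  assumes run: "model_based_run M P fm r \<omega> t K x0 \<xi> X kb"
    and t_pos: "\<And>k. 0 < t k" and t_rho: "\<And>k. t k * \<rho> < 1" and t_tau: "\<And>k. t k * \<tau> < 1"
    and x0_dom: "x0 \<in> dom_r"
begin

sublocale RM: prob_space M
  using run by (simp add: model_based_run_def)

lemma xi_measurable: "k < K \<Longrightarrow> \<xi> k \<in> measurable M P"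
  using run by (auto simp: model_based_run_def RM.indep_vars_def)

lemma X_measurable: "k \<le> K \<Longrightarrow> X k \<in> borel_measurable M"
  using run by (auto simp: model_based_run_def)

lemma X_0: "w \<in> space M \<Longrightarrow> X 0 w = x0"
  using run by (auto simp: model_based_run_def)

lemma X_arg_min: "k < K \<Longrightarrow> AE w in M. model_arg_min (t k) (X k w) (\<xi> k w) (X (Suc k) w)"
  using run by (auto simp: model_based_run_def model_arg_min_def)

text \<open>The iterates of a run are specified only almost surely and as some minimizers; this
  recursion is a genuine measurable function of the sample sequence.\<close>

primrec iterate :: "nat \<Rightarrow> (nat \<Rightarrow> 'o) \<Rightarrow> 'a" where
  "iterate 0 s = x0"
| "iterate (Suc k) s = model_step (t k) (iterate k s) (s k)"

lemma iterate_cong: "(\<And>i. i < k \<Longrightarrow> s i = s' i) \<Longrightarrow> iterate k s = iterate k s'"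
  by (induction k) auto

lemma iterate_measurable: "{..<k} \<subseteq> J \<Longrightarrow> iterate k \<in> borel_measurable (Pi\<^sub>M J (\<lambda>_. P))"
proof (induction k)
  case (Suc k)
  then have [measurable]: "iterate k \<in> borel_measurable (Pi\<^sub>M J (\<lambda>_. P))"
    by (metis lessThan_subset_iff le_SucI order_refl order_trans)
  from Suc have [measurable]: "(\<lambda>s. s k) \<in> measurable (Pi\<^sub>M J (\<lambda>_. P)) P"
    by (auto intro!: measurable_component_singleton)
  have "iterate (Suc k) = (\<lambda>s. model_step (t k) (iterate k s) (s k))" by auto
  then show ?case by simp
next
  case 0
  have "iterate 0 = (\<lambda>_. x0)" by auto
  then show ?case by simp
qed

lemma X_eq_iterate: "k \<le> K \<Longrightarrow> AE w in M. X k w = iterate k (\<lambda>i. \<xi> i w)"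
proof (induction k)
  case 0
  show ?case using X_0 by simp
next
  case (Suc k)
  then have "AE w in M. X k w = iterate k (\<lambda>i. \<xi> i w)" "k < K" by auto
  from this(1) X_arg_min[OF this(2)] AE_space show ?case
  proof eventually_elim
    case (elim w)
    have "\<xi> k w \<in> space P" using xi_measurable[OF \<open>k < K\<close>] elim(3) by (rule measurable_space)
    then show ?case
      using model_step_eq[OF _ elim(2) t_pos t_rho] elim(1) by simp
  qed
qed

text \<open>The current iterate is a function of the past samples, hence independent of the new one.\<close>

lemma joint_distribution:
  assumes k: "k < K"
  shows "distr M (borel \<Otimes>\<^sub>M P) (\<lambda>w. (X k w, \<xi> k w)) = distr M borel (X k) \<Otimes>\<^sub>M P"
proof -
  \<comment> \<open>Independence is available for restrictions to disjoint index blocks, so the new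
    sample is treated as a block with the single index \<open>k\<close>.\<close>
  let ?U = "\<lambda>w. \<lambda>i\<in>{..<k}. \<xi> i w" and ?V = "\<lambda>w. \<lambda>i\<in>{k}. \<xi> i w"
  let ?Y = "\<lambda>w. iterate k (?U w)"
  have "RM.indep_vars (\<lambda>_. P) \<xi> {..<K}" using run by (simp add: model_based_run_def)
  then have "RM.indep_var (Pi\<^sub>M {..<k} (\<lambda>_. P)) (\<lambda>w. \<lambda>i\<in>{..<k}. \<xi> i w)
      (Pi\<^sub>M {k} (\<lambda>_. P)) (\<lambda>w. \<lambda>i\<in>{k}. \<xi> i w)"
    using k by (intro RM.indep_var_restrict[where I = "{..<K}"]) auto
  then have ind: "RM.indep_var (Pi\<^sub>M {..<k} (\<lambda>_. P)) ?U (Pi\<^sub>M {k} (\<lambda>_. P)) ?V" .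
  note rv [measurable] = RM.indep_var_rv1[OF ind] RM.indep_var_rv2[OF ind]
  have it [measurable]: "iterate k \<in> borel_measurable (Pi\<^sub>M {..<k} (\<lambda>_. P))"
    by (rule iterate_measurable) simp
  have ev [measurable]: "(\<lambda>s. s k) \<in> measurable (Pi\<^sub>M {k} (\<lambda>_. P)) P"
    by (rule measurable_component_singleton) simp
  have Ym: "?Y \<in> borel_measurable M"
    using measurable_compose[OF rv(1) it] .
  \<comment> \<open>\<open>iterate k\<close> reads only indices below \<open>k\<close>, so
    restricting the samples to that block changes nothing.\<close>
  have XY: "AE w in M. X k w = ?Y w"
    using X_eq_iterate[of k] k by (simp cong: iterate_cong)
  have [measurable]: "\<xi> k \<in> measurable M P" "X k \<in> borel_measurable M" "?Y \<in> borel_measurable M"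
    using xi_measurable[OF k] X_measurable[of k] k Ym by auto
  have "distr M (borel \<Otimes>\<^sub>M P) (\<lambda>w. (X k w, \<xi> k w)) = distr M (borel \<Otimes>\<^sub>M P) (\<lambda>w. (?Y w, \<xi> k w))"
    using XY by (intro distr_cong_AE) auto
  also have "\<dots> = distr (distr M (Pi\<^sub>M {..<k} (\<lambda>_. P) \<Otimes>\<^sub>M Pi\<^sub>M {k} (\<lambda>_. P)) (\<lambda>w. (?U w, ?V w)))
      (borel \<Otimes>\<^sub>M P) (\<lambda>(u, v). (iterate k u, v k))"
    by (subst distr_distr) (auto simp: comp_def)
  also have "\<dots> = distr (distr M (Pi\<^sub>M {..<k} (\<lambda>_. P)) ?U \<Otimes>\<^sub>M distr M (Pi\<^sub>M {k} (\<lambda>_. P)) ?V)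
      (borel \<Otimes>\<^sub>M P) (\<lambda>(u, v). (iterate k u, v k))"
    using ind unfolding RM.indep_var_distribution_eq by simp
  also have "\<dots> = distr (distr M (Pi\<^sub>M {..<k} (\<lambda>_. P)) ?U) borel (iterate k)
      \<Otimes>\<^sub>M distr (distr M (Pi\<^sub>M {k} (\<lambda>_. P)) ?V) P (\<lambda>s. s k)"
  proof (rule pair_measure_distr[symmetric])
    interpret V: prob_space "distr (distr M (Pi\<^sub>M {k} (\<lambda>_. P)) ?V) P (\<lambda>s. s k)"
      by (intro prob_space.prob_space_distr RM.prob_space_distr) simp_all
    show "sigma_finite_measure (distr (distr M (Pi\<^sub>M {k} (\<lambda>_. P)) ?V) P (\<lambda>s. s k))" ..
  qed simp_all
  also have "\<dots> = distr M borel ?Y \<Otimes>\<^sub>M distr M P (\<xi> k)"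
    by (simp add: distr_distr comp_def)
  also have "distr M P (\<xi> k) = P" using run k by (simp add: model_based_run_def)
  also have "distr M borel ?Y = distr M borel (X k)"
    using XY by (intro distr_cong_AE) auto
  finally show ?thesis .
qed

text \<open>The product law lets the new sample be integrated out with the current iterate frozen,
  in place of a conditional expectation. Absolute integrability is asked for in iterated form, which
  is how \<open>expectation_abs_deviation_le\<close> provides it.\<close>

lemma joint_integral:
  fixes g :: "'a \<Rightarrow> 'o \<Rightarrow> real"
  assumes k: "k < K" and g: "(\<lambda>(x, \<xi>). g x \<xi>) \<in> borel_measurable (borel \<Otimes>\<^sub>M P)"
    and int: "\<And>x. integrable P (\<lambda>\<xi>. g x \<xi>)"
    and int': "integrable M (\<lambda>w. \<integral>\<xi>. \<bar>g (X k w) \<xi>\<bar> \<partial>P)"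
  shows "integrable M (\<lambda>w. g (X k w) (\<xi> k w))"
    and "(\<integral>w. g (X k w) (\<xi> k w) \<partial>M) = (\<integral>w. (\<integral>\<xi>. g (X k w) \<xi> \<partial>P) \<partial>M)"
    and "integrable M (\<lambda>w. \<integral>\<xi>. g (X k w) \<xi> \<partial>P)"
proof -
  have [measurable]: "\<xi> k \<in> measurable M P" "X k \<in> borel_measurable M"
    using xi_measurable[OF k] X_measurable[of k] k by auto
  note g[measurable]
  let ?N = "distr M borel (X k)"
  interpret N: prob_space ?N by (rule RM.prob_space_distr) simp
  interpret NP: pair_sigma_finite ?N P ..
  have sN: "sets (?N \<Otimes>\<^sub>M P) = sets (borel \<Otimes>\<^sub>M P)" by (intro sets_pair_measure_cong) simp_all
  have gN: "(\<lambda>(x, \<xi>). g x \<xi>) \<in> borel_measurable (?N \<Otimes>\<^sub>M P)" using g by (simp add: measurable_cong_sets[OF sN refl])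
  have m1: "(\<lambda>x. \<integral>\<xi>. \<bar>g x \<xi>\<bar> \<partial>P) \<in> borel_measurable borel"
    "(\<lambda>x. \<integral>\<xi>. g x \<xi> \<partial>P) \<in> borel_measurable borel"
    by measurable
  have i1: "integrable ?N (\<lambda>x. \<integral>\<xi>. \<bar>g x \<xi>\<bar> \<partial>P)"
    using int' m1 by (simp add: integrable_distr_eq)
  have i2: "integrable (?N \<Otimes>\<^sub>M P) (\<lambda>(x, \<xi>). g x \<xi>)"
    using i1 int gN by (intro NP.Fubini_integrable) auto
  then show "integrable M (\<lambda>w. g (X k w) (\<xi> k w))"
    unfolding joint_distribution[OF k, symmetric] by (simp add: integrable_distr_eq)
  have "(\<integral>w. g (X k w) (\<xi> k w) \<partial>M) = integral\<^sup>L (?N \<Otimes>\<^sub>M P) (\<lambda>(x, \<xi>). g x \<xi>)"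
    unfolding joint_distribution[OF k, symmetric] by (simp add: integral_distr)
  also have "\<dots> = (\<integral>x. (\<integral>\<xi>. g x \<xi> \<partial>P) \<partial>?N)"
    using NP.integral_fst'[OF i2] by simp
  also have "\<dots> = (\<integral>w. (\<integral>\<xi>. g (X k w) \<xi> \<partial>P) \<partial>M)"
    using m1 by (simp add: integral_distr)
  finally show "(\<integral>w. g (X k w) (\<xi> k w) \<partial>M) = (\<integral>w. (\<integral>\<xi>. g (X k w) \<xi> \<partial>P) \<partial>M)" .
  show "integrable M (\<lambda>w. \<integral>\<xi>. g (X k w) \<xi> \<partial>P)"
    using NP.integrable_fst'[OF i2] m1 by (simp add: integrable_distr_eq)
qed

text \<open>For one \<open>q\<close> the exceptional samples may vary with the base point, but every
  section is null, so the product law makes the whole exceptional set null; countability of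
  \<open>Q\<close> then handles all \<open>q\<close> at once.\<close>

lemma lipschitz_run:
  assumes k: "k < K"
  shows "AE w in M. \<forall>q\<in>Q. fm (X k w) (X k w) (\<xi> k w) - fm (X k w) q (\<xi> k w)
      \<le> Lt (X k w) (\<xi> k w) * sqrt (bregman \<omega> q (X k w))"
proof -
  have [measurable]: "\<xi> k \<in> measurable M P" "X k \<in> borel_measurable M"
    using xi_measurable[OF k] X_measurable[of k] k by auto
  let ?N = "distr M borel (X k)"
  interpret N: prob_space ?N by (rule RM.prob_space_distr) simp
  interpret NP: pair_sigma_finite ?N P ..
  have sN: "sets (?N \<Otimes>\<^sub>M P) = sets (borel \<Otimes>\<^sub>M P)" by (intro sets_pair_measure_cong) simp_all
  let ?P = "\<lambda>q (x, \<xi>). fm x x \<xi> - fm x q \<xi> \<le> Lt x \<xi> * sqrt (bregman \<omega> q x)"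
  have "AE w in M. fm (X k w) (X k w) (\<xi> k w) - fm (X k w) q (\<xi> k w)
      \<le> Lt (X k w) (\<xi> k w) * sqrt (bregman \<omega> q (X k w))" for q
  proof -
    have "AE \<xi> in P. fm x x \<xi> - fm x q \<xi> \<le> Lt x \<xi> * sqrt (bregman \<omega> q x)" for x
      using lipschitz[of x q] AE_space
    proof eventually_elim
      case (elim \<xi>)
      have "Lt x \<xi> * sqrt (min (bregman \<omega> x q) (bregman \<omega> q x)) \<le> Lt x \<xi> * sqrt (bregman \<omega> q x)"
        using Lt_nonneg[OF elim(2)] by (intro mult_left_mono) auto
      then show ?case using elim(1) by linarith
    qed
    moreover have "{p \<in> space (borel \<Otimes>\<^sub>M P). ?P q p} \<in> sets (borel \<Otimes>\<^sub>M P)"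
      unfolding case_prod_beta by measurable
    then have "{p \<in> space (?N \<Otimes>\<^sub>M P). ?P q p} \<in> sets (?N \<Otimes>\<^sub>M P)"
      unfolding sN by (simp add: space_pair_measure)
    ultimately have "AE p in ?N \<Otimes>\<^sub>M P. ?P q p"
      by (intro NP.AE_pair_measure) auto
    then have "AE p in distr M (borel \<Otimes>\<^sub>M P) (\<lambda>w. (X k w, \<xi> k w)). ?P q p"
      unfolding joint_distribution[OF k] .
    from AE_distrD[OF _ this] show ?thesis by simp
  qed
  then show ?thesis using Q(1) by (simp add: AE_ball_countable)
qed

section \<open>Moments along the run and the expected step\<close>

definition decay :: "nat \<Rightarrow> real" where "decay k = t k / (1 - t k * \<rho>)"

definition noise :: "nat \<Rightarrow> real" where "noise k = (t k)\<^sup>2 / ((1 - t k * \<rho>) * (1 - t k * \<tau>))"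

definition "e_env k = (\<integral>w. env (X k w) - Fmin \<partial>M)"
definition "e_gap k = (\<integral>w. Fr (X k w) - Fmin \<partial>M)"
definition "e_sym k = (\<integral>w. bregman_sym \<omega> lam (prx (X k w)) (X k w) \<partial>M)"
definition "e_lip k = (\<integral>w. lip2 (X k w) \<partial>M)"

lemma decay_pos: "0 < decay k" and noise_pos: "0 < noise k"
  using t_pos[of k] t_rho[of k] t_tau[of k] by (auto simp: decay_def noise_def)

text \<open>The objective gap dominates everything: on the domain the envelope lies below the
  objective, \<open>lip2\<close> and the distance D(p, x) are controlled by the envelope, and the
  reversed distance is at most the gap divided by \<open>mu\<close>.\<close>

lemma integrable_moments:
  assumes k: "k \<le> K" and gap: "integrable M (\<lambda>w. Fr (X k w) - Fmin)"
    and dom: "AE w in M. X k w \<in> dom_r"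
    and bound: "\<And>x. lip2 x \<le> \<alpha> * (env x - Fmin) + \<beta>"
  shows "integrable M (\<lambda>w. env (X k w) - Fmin)"
    and "integrable M (\<lambda>w. lip2 (X k w))"
    and "integrable M (\<lambda>w. bregman \<omega> (prx (X k w)) (X k w))"
    and "integrable M (\<lambda>w. bregman_sym \<omega> lam (prx (X k w)) (X k w))"
proof -
  have [measurable]: "X k \<in> borel_measurable M" using X_measurable[OF k] .
  show env: "integrable M (\<lambda>w. env (X k w) - Fmin)"
    using dom by (intro integrable_nonneg_bound[OF gap]) (auto simp: Fmin_le_env env_le_Fr)
  then have "integrable M (\<lambda>w. \<alpha> * (env (X k w) - Fmin) + \<beta>)"
    by (intro Bochner_Integration.integrable_add Bochner_Integration.integrable_mult_right RM.integrable_const)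
  then show "integrable M (\<lambda>w. lip2 (X k w))"
    by (rule integrable_nonneg_bound) (auto simp: lip2_nonneg bound)
  have "integrable M (\<lambda>w. lam * (env (X k w) - Fmin))"
    using env by (rule Bochner_Integration.integrable_mult_right)
  then show D: "integrable M (\<lambda>w. bregman \<omega> (prx (X k w)) (X k w))"
    by (rule integrable_nonneg_bound) (auto simp: bregman_prx_le)
  have "integrable M (\<lambda>w. (Fr (X k w) - Fmin) / mu)" using gap by (rule integrable_divide_zero[OF _])
  then have "integrable M (\<lambda>w. bregman \<omega> (X k w) (prx (X k w)))"
  proof (rule integrable_nonneg_bound)
    show "AE w in M. bregman \<omega> (X k w) (prx (X k w)) \<le> (Fr (X k w) - Fmin) / mu"
      using dom
    proof eventually_elim
      case (elim w)
      have "mu * bregman \<omega> (X k w) (prx (X k w)) \<le> Fr (X k w) - Fmin"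
        using prx_inequality[OF elim, of "X k w"] Fmin_le_env[of "X k w"] by simp
      then show ?case using mu_pos by (simp add: field_simps)
    qed
  qed auto
  then show "integrable M (\<lambda>w. bregman_sym \<omega> lam (prx (X k w)) (X k w))"
    unfolding bregman_sym_def using D
    by (intro Bochner_Integration.integrable_mult_right Bochner_Integration.integrable_add)
qed

lemma integrable_deviation_run:
  assumes k: "k < K" and gap: "integrable M (\<lambda>w. Fr (X k w) - Fmin)"
    and dom: "AE w in M. X k w \<in> dom_r"
    and bound: "\<And>x. lip2 x \<le> \<alpha> * (env x - Fmin) + \<beta>" and \<alpha>: "0 \<le> \<alpha>"
  shows "integrable M (\<lambda>w. deviation (X k w) (\<xi> k w))"
    and "(\<integral>w. deviation (X k w) (\<xi> k w) \<partial>M) \<le> (\<integral>w. \<tau> * bregman \<omega> (prx (X k w)) (X k w) \<partial>M)"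
proof -
  have [measurable]: "X k \<in> borel_measurable M" using X_measurable k by simp
  note int = integrable_moments[OF less_imp_le[OF k] gap dom bound]
  have [measurable]: "(\<lambda>(x, \<xi>). deviation x \<xi>) \<in> borel_measurable (borel \<Otimes>\<^sub>M P)"
    unfolding deviation_def by measurable
  have "integrable M (\<lambda>w. (2 * \<alpha> + 3 * \<tau> * lam + 2 * lam) * (env (X k w) - Fmin) + 2 * \<beta>)"
    using int(1) by (intro Bochner_Integration.integrable_add Bochner_Integration.integrable_mult_right RM.integrable_const)
  then have "integrable M (\<lambda>w. \<integral>\<xi>. \<bar>deviation (X k w) \<xi>\<bar> \<partial>P)"
    by (rule integrable_nonneg_bound) (auto intro!: expectation_abs_deviation_le[OF bound \<alpha>])
  note J = joint_integral[OF k, of deviation, OF _ deviation_integrable this]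
  show "integrable M (\<lambda>w. deviation (X k w) (\<xi> k w))" by (rule J) measurable
  have "(\<integral>w. deviation (X k w) (\<xi> k w) \<partial>M) = (\<integral>w. (\<integral>\<xi>. deviation (X k w) \<xi> \<partial>P) \<partial>M)"
    by (rule J) measurable
  also have "\<dots> \<le> (\<integral>w. \<tau> * bregman \<omega> (prx (X k w)) (X k w) \<partial>M)"
    by (intro integral_mono J Bochner_Integration.integrable_mult_right int expectation_deviation_le) measurable
  finally show "(\<integral>w. deviation (X k w) (\<xi> k w) \<partial>M) \<le> (\<integral>w. \<tau> * bregman \<omega> (prx (X k w)) (X k w) \<partial>M)" .
qed

lemma integrable_Lt_run:
  assumes k: "k < K" and int: "integrable M (\<lambda>w. lip2 (X k w))"
  shows "integrable M (\<lambda>w. (Lt (X k w) (\<xi> k w))\<^sup>2)"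
    and "(\<integral>w. (Lt (X k w) (\<xi> k w))\<^sup>2 \<partial>M) = e_lip k"
proof -
  have [measurable]: "(\<lambda>(x, \<xi>). (Lt x \<xi>)\<^sup>2) \<in> borel_measurable (borel \<Otimes>\<^sub>M P)" by measurable
  have "integrable M (\<lambda>w. \<integral>\<xi>. \<bar>(Lt (X k w) \<xi>)\<^sup>2\<bar> \<partial>P)" using int by (simp add: lip2_def)
  note J = joint_integral[OF k, of "\<lambda>x \<xi>. (Lt x \<xi>)\<^sup>2", OF _ Lt_square_integrable this]
  show "integrable M (\<lambda>w. (Lt (X k w) (\<xi> k w))\<^sup>2)" by (rule J) measurable
  have "(\<integral>w. (Lt (X k w) (\<xi> k w))\<^sup>2 \<partial>M) = (\<integral>w. (\<integral>\<xi>. (Lt (X k w) \<xi>)\<^sup>2 \<partial>P) \<partial>M)"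
    by (rule J) measurable
  then show "(\<integral>w. (Lt (X k w) (\<xi> k w))\<^sup>2 \<partial>M) = e_lip k"
    by (simp add: e_lip_def lip2_def)
qed

text \<open>The noise at the next iterate involves the envelope there, whose integrability is not
  yet known. \<open>small\<close> lets the envelope gap on the left absorb it pointwise, which makes
  the next objective gap integrable; only then can the pathwise inequality be averaged.\<close>

lemma step_expectation:
  assumes k: "k < K" and gap: "integrable M (\<lambda>w. Fr (X k w) - Fmin)"
    and dom: "AE w in M. X k w \<in> dom_r"
    and bound: "\<And>x. lip2 x \<le> \<alpha> * (env x - Fmin) + \<beta>" and \<alpha>: "0 \<le> \<alpha>"
    and small: "\<alpha> / lam * noise k \<le> 1"
  shows "integrable M (\<lambda>w. Fr (X (Suc k) w) - Fmin)"
    and "AE w in M. X (Suc k) w \<in> dom_r"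
    and "e_env (Suc k) + decay k / lam * e_gap (Suc k) + (1 - lam * (\<tau> + \<rho>)) * (t k * e_sym k)
      \<le> e_env k + decay k / lam * e_gap k + noise k / (2 * lam) * (e_lip k + e_lip (Suc k))"
proof -
  have [measurable]: "X k \<in> borel_measurable M" "X (Suc k) \<in> borel_measurable M"
    using X_measurable k by auto
  have ae: "AE w in M. \<xi> k w \<in> space P \<and> model_arg_min (t k) (X k w) (\<xi> k w) (X (Suc k) w) \<and>
      (\<forall>q\<in>Q. fm (X k w) (X k w) (\<xi> k w) - fm (X k w) q (\<xi> k w)
      \<le> Lt (X k w) (\<xi> k w) * sqrt (bregman \<omega> q (X k w)))"
    using AE_space X_arg_min[OF k] lipschitz_run[OF k]
    by eventually_elim (use xi_measurable[OF k] in \<open>auto intro: measurable_space\<close>)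
  show dom': "AE w in M. X (Suc k) w \<in> dom_r"
    using ae by eventually_elim (use model_arg_minD(1) in blast)
  note int = integrable_moments[OF less_imp_le[OF k] gap dom bound]
  note dev = integrable_deviation_run[OF k gap dom bound \<alpha>]
  note Lt = integrable_Lt_run[OF k int(2)]
  define G where "G w = Fr (prx (X k w)) - Fmin" for w
  define D where "D w = bregman \<omega> (prx (X k w)) (X k w)" for w
  define R where "R w = G w + decay k / lam * (deviation (X k w) (\<xi> k w) + G w + 1 / t k * D w)
      + noise k / (2 * lam) * (Lt (X k w) (\<xi> k w))\<^sup>2" for w
  have "integrable M (\<lambda>w. env (X k w) - Fmin - D w / lam)"
    using int(1,3) unfolding D_def
    by (rule Bochner_Integration.integrable_diff[OF _ integrable_divide])
  moreover have "G = (\<lambda>w. env (X k w) - Fmin - D w / lam)"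
    by (simp add: G_def D_def fun_eq_iff gap_prx_le[symmetric])
  ultimately have Gint: "integrable M G" by simp
  have Dint: "integrable M D" using int(3) by (simp add: D_def[abs_def])
  have Rint: "integrable M R"
    unfolding R_def
    by (intro Bochner_Integration.integrable_add Bochner_Integration.integrable_mult_right Gint Dint dev Lt)
  have path: "AE w in M. (env (X (Suc k) w) - Fmin) + decay k / lam * (Fr (X (Suc k) w) - Fmin)
      \<le> R w + noise k / (2 * lam) * lip2 (X (Suc k) w)"
    using ae
  proof eventually_elim
    case (elim w)
    then show ?case
      using step_pathwise[of "\<xi> k w" "t k" "X k w" "X (Suc k) w"] t_pos t_rho t_tau
      by (simp add: R_def G_def D_def decay_def noise_def distrib_left)
  qed
  have dl: "0 < decay k / lam" using decay_pos lam_pos by simp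
  have small': "noise k / (2 * lam) * lip2 x \<le> 1 / 2 * (env x - Fmin) + noise k / (2 * lam) * \<beta>" for x
  proof -
    have "noise k / (2 * lam) * lip2 x \<le> noise k / (2 * lam) * (\<alpha> * (env x - Fmin) + \<beta>)"
      using noise_pos[of k] lam_pos bound by (intro mult_left_mono) auto
    also have "\<dots> = \<alpha> / lam * noise k * (1 / 2 * (env x - Fmin)) + noise k / (2 * lam) * \<beta>"
      by (simp add: distrib_left mult_ac)
    also have "\<alpha> / lam * noise k * (1 / 2 * (env x - Fmin)) \<le> 1 * (1 / 2 * (env x - Fmin))"
      using small Fmin_le_env[of x] by (intro mult_right_mono) auto
    finally show ?thesis by simp
  qed
  have "integrable M (\<lambda>w. (R w + noise k / (2 * lam) * \<beta>) / (decay k / lam))"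
    by (intro integrable_divide Bochner_Integration.integrable_add Rint RM.integrable_const)
  then show gap': "integrable M (\<lambda>w. Fr (X (Suc k) w) - Fmin)"
  proof (rule integrable_nonneg_bound)
    show "AE w in M. 0 \<le> Fr (X (Suc k) w) - Fmin"
      using dom' by eventually_elim (simp add: Fmin_le)
    show "AE w in M. Fr (X (Suc k) w) - Fmin \<le> (R w + noise k / (2 * lam) * \<beta>) / (decay k / lam)"
      using path
    proof eventually_elim
      case (elim w)
      have "(Fr (X (Suc k) w) - Fmin) * (decay k / lam) \<le> R w + noise k / (2 * lam) * \<beta>"
        using elim small'[of "X (Suc k) w"] Fmin_le_env[of "X (Suc k) w"] by argo
      then show ?case using pos_le_divide_eq[OF dl] by blast
    qed
  qed measurable
  have k': "Suc k \<le> K" using k by simp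
  note int' = integrable_moments[OF k' gap' dom' bound]
  have "e_env (Suc k) + decay k / lam * e_gap (Suc k)
      = (\<integral>w. (env (X (Suc k) w) - Fmin) + decay k / lam * (Fr (X (Suc k) w) - Fmin) \<partial>M)"
    using int'(1) gap' unfolding e_env_def e_gap_def
    by (subst Bochner_Integration.integral_add) simp_all
  also have "\<dots> \<le> (\<integral>w. R w + noise k / (2 * lam) * lip2 (X (Suc k) w) \<partial>M)"
    using path
    by (intro integral_mono_AE Bochner_Integration.integrable_add Bochner_Integration.integrable_mult_right
        int' gap' Rint)
  also have "\<dots> = (\<integral>w. R w \<partial>M) + noise k / (2 * lam) * e_lip (Suc k)"
    using int'(2) Rint by (simp add: e_lip_def)
  also have "(\<integral>w. R w \<partial>M) = (\<integral>w. G w \<partial>M)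
      + decay k / lam * ((\<integral>w. deviation (X k w) (\<xi> k w) \<partial>M) + (\<integral>w. G w \<partial>M) + 1 / t k * (\<integral>w. D w \<partial>M))
      + noise k / (2 * lam) * e_lip k"
    unfolding R_def Lt(2)[symmetric]
    using Gint Dint dev(1) Lt(1) by simp
  also have "\<dots> \<le> (\<integral>w. G w \<partial>M)
      + decay k / lam * ((\<integral>w. \<tau> * D w \<partial>M) + (\<integral>w. G w \<partial>M) + 1 / t k * (\<integral>w. D w \<partial>M))
      + noise k / (2 * lam) * e_lip k"
    using dev(2) dl unfolding D_def
    by (intro add_mono mult_left_mono order_refl) auto
  also have "(\<integral>w. G w \<partial>M)
      + decay k / lam * ((\<integral>w. \<tau> * D w \<partial>M) + (\<integral>w. G w \<partial>M) + 1 / t k * (\<integral>w. D w \<partial>M))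
      = (\<integral>w. G w + decay k / lam * (\<tau> * D w + G w + 1 / t k * D w) \<partial>M)"
    using Gint Dint by simp
  also have "\<dots> \<le> (\<integral>w. (env (X k w) - Fmin) + decay k / lam * (Fr (X k w) - Fmin)
      - (1 - lam * (\<tau> + \<rho>)) * (t k * bregman_sym \<omega> lam (prx (X k w)) (X k w)) \<partial>M)"
  proof (intro integral_mono_AE)
    show "AE w in M. G w + decay k / lam * (\<tau> * D w + G w + 1 / t k * D w)
      \<le> (env (X k w) - Fmin) + decay k / lam * (Fr (X k w) - Fmin)
      - (1 - lam * (\<tau> + \<rho>)) * (t k * bregman_sym \<omega> lam (prx (X k w)) (X k w))"
      using dom
    proof eventually_elim
      case (elim w)
      then show ?case
        unfolding G_def D_def decay_def by (intro step_drift t_pos t_rho)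
    qed
  qed (intro Bochner_Integration.integrable_add Bochner_Integration.integrable_diff
      Bochner_Integration.integrable_mult_right int gap Gint Dint)+
  also have "\<dots> = e_env k + decay k / lam * e_gap k - (1 - lam * (\<tau> + \<rho>)) * (t k * e_sym k)"
  proof -
    define H where "H w = (1 - lam * (\<tau> + \<rho>)) * (t k * bregman_sym \<omega> lam (prx (X k w)) (X k w))" for w
    define J where "J w = decay k / lam * (Fr (X k w) - Fmin)" for w
    have 1: "integrable M H" "integrable M J" unfolding H_def J_def
      by (intro Bochner_Integration.integrable_mult_right int gap)+
    have 2: "integral\<^sup>L M H = (1 - lam * (\<tau> + \<rho>)) * (t k * e_sym k)"
      "integral\<^sup>L M J = decay k / lam * e_gap k"
      unfolding H_def J_def e_sym_def e_gap_def by simp_all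
    show ?thesis
      unfolding H_def[symmetric] J_def[symmetric] e_env_def 2[symmetric]
      using int(1) 1 by (subst Bochner_Integration.integral_diff Bochner_Integration.integral_add;
          (intro Bochner_Integration.integrable_add)?; simp)+
  qed
  finally show "e_env (Suc k) + decay k / lam * e_gap (Suc k) + (1 - lam * (\<tau> + \<rho>)) * (t k * e_sym k)
      \<le> e_env k + decay k / lam * e_gap k + noise k / (2 * lam) * (e_lip k + e_lip (Suc k))"
    by (simp add: distrib_left)
qed

end

section \<open>The recursion for the expected values\<close>

text \<open>With \<open>e\<close> bounded by its maximum \<open>B\<close>, the telescoped inequality
  is read twice: at an index attaining \<open>B\<close> it bounds \<open>B\<close> itself, and at
  \<open>K\<close> it gives the claim. This yields the denominator 1 - \<alpha> S / \<lambda>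
  instead of an exponential factor.\<close>

lemma descent_recursion:
  fixes e g D l a t c :: "nat \<Rightarrow> real"
  assumes step: "\<And>k. k < K \<Longrightarrow> e (Suc k) + a k / lam * g (Suc k) + \<kappa> * (t k * D k)
      \<le> e k + a k / lam * g k + c k / (2 * lam) * (l k + l (Suc k))"
    and l: "\<And>k. k \<le> K \<Longrightarrow> l k \<le> \<alpha> * e k + \<beta>"
    and e: "\<And>k. k \<le> K \<Longrightarrow> 0 \<le> e k" and g: "\<And>k. k \<le> K \<Longrightarrow> 0 \<le> g k"
    and a: "\<And>k. a (Suc k) \<le> a k" "\<And>k. 0 \<le> a k" and c: "\<And>k. 0 \<le> c k"
    and lam: "0 < lam" and \<alpha>: "0 \<le> \<alpha>" and \<beta>: "0 \<le> \<beta>"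
    and D: "\<And>k. k < K \<Longrightarrow> 0 \<le> \<kappa> * (t k * D k)"
    and small: "\<alpha> / lam * (\<Sum>k<K. c k) < 1"
  shows "\<kappa> * (\<Sum>k<K. t k * D k)
      \<le> (e 0 + a 0 / lam * g 0 + \<beta> / lam * (\<Sum>k<K. c k)) / (1 - \<alpha> / lam * (\<Sum>k<K. c k))"
proof -
  define B where "B = Max (e ` {..K})"
  define S where "S = (\<Sum>k<K. c k)"
  define A where "A = e 0 + a 0 / lam * g 0"
  define q where "q = (\<alpha> * B + \<beta>) / lam"
  have B: "e k \<le> B" if "k \<le> K" for k unfolding B_def using that by (intro Max_ge) auto
  have "0 \<le> B" using e[of 0] B[of 0] by simp
  then have q: "0 \<le> q" using \<alpha> \<beta> lam by (simp add: q_def)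
  have lB: "l k \<le> \<alpha> * B + \<beta>" if "k \<le> K" for k
    using l[OF that] mult_left_mono[OF B[OF that] \<alpha>] by simp
  have inv: "e m + a m / lam * g m + (\<Sum>k<m. \<kappa> * (t k * D k)) \<le> A + q * (\<Sum>k<m. c k)" if "m \<le> K" for m
    using that
  proof (induction m)
    case 0
    show ?case by (simp add: A_def)
  next
    case (Suc m)
    \<comment> \<open>The halves from the two ends of a step add up, so \<open>c m\<close> enters
      with 1 / \<lambda> and not 1 / (2 \<lambda>).\<close>
    have "c m / (2 * lam) * (l m + l (Suc m)) \<le> c m / (2 * lam) * ((\<alpha> * B + \<beta>) + (\<alpha> * B + \<beta>))"
      using lB[of m] lB[of "Suc m"] Suc.prems c[of m] lam by (intro mult_left_mono add_mono) auto
    also have "\<dots> = q * c m" using lam by (simp add: q_def field_simps)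
    finally have 1: "c m / (2 * lam) * (l m + l (Suc m)) \<le> q * c m" .
    \<comment> \<open>Here nonincreasing weights are essential: the gap weight left by step
      \<open>m\<close> dominates the one required by the next step.\<close>
    have 2: "a (Suc m) / lam * g (Suc m) \<le> a m / lam * g (Suc m)"
      using a g[OF Suc.prems] lam by (intro mult_right_mono divide_right_mono) auto
    have "m < K" "m \<le> K" using Suc.prems by auto
    then show ?case using 1 2 step[of m] Suc.IH by (simp add: distrib_left)
  qed
  have nn: "0 \<le> a m / lam * g m" "0 \<le> (\<Sum>k<m. \<kappa> * (t k * D k))" "q * (\<Sum>k<m. c k) \<le> q * S" if "m \<le> K" for m
  proof -
    show "0 \<le> a m / lam * g m" using a lam g[OF that] by simp
    show "0 \<le> (\<Sum>k<m. \<kappa> * (t k * D k))" using D that by (intro sum_nonneg) auto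
    have "(\<Sum>k<m. c k) \<le> S" unfolding S_def using that c by (intro sum_mono2) auto
    then show "q * (\<Sum>k<m. c k) \<le> q * S" using q by (rule mult_left_mono)
  qed
  have "B \<in> e ` {..K}" unfolding B_def by (intro Max_in) auto
  then obtain m where "m \<le> K" "B = e m" by auto
  then have "B \<le> A + q * S" using inv[of m] nn[of m] by linarith
  also have qS: "q * S = \<alpha> / lam * S * B + \<beta> / lam * S"
    by (simp add: q_def field_simps add_divide_distrib)
  finally have "B * (1 - \<alpha> / lam * S) \<le> A + \<beta> / lam * S" by (simp add: algebra_simps)
  then have B': "B \<le> (A + \<beta> / lam * S) / (1 - \<alpha> / lam * S)"
    using small by (simp add: pos_le_divide_eq S_def)
  have S0: "0 \<le> \<alpha> / lam * S" using \<alpha> lam c by (simp add: S_def sum_nonneg)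
  have "(\<Sum>k<K. \<kappa> * (t k * D k)) \<le> A + q * S"
    using inv[of K] nn[of K] e[of K] by (simp add: S_def)
  also have "\<dots> = (A + \<beta> / lam * S) + \<alpha> / lam * S * B" by (simp add: qS)
  also have "\<dots> \<le> (A + \<beta> / lam * S) + \<alpha> / lam * S * ((A + \<beta> / lam * S) / (1 - \<alpha> / lam * S))"
    using B' S0 by (intro add_left_mono mult_left_mono)
  also have "\<dots> = (A + \<beta> / lam * S) / (1 - \<alpha> / lam * S)"
  proof -
    have "x + y * (x / (1 - y)) = x / (1 - y)" if "y < 1" for x y :: real
      using that by (simp add: field_simps)
    moreover have "\<alpha> / lam * S < 1" using small by (simp only: S_def)
    ultimately show ?thesis by blast
  qed
  finally show ?thesis by (simp add: A_def S_def sum_distrib_left)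
qed

context model_run
begin

lemma run_integrable:
  assumes bound: "\<And>x. lip2 x \<le> \<alpha> * (env x - Fmin) + \<beta>" and \<alpha>: "0 \<le> \<alpha>"
    and small: "\<And>k. k < K \<Longrightarrow> \<alpha> / lam * noise k \<le> 1"
    and k: "k \<le> K"
  shows "integrable M (\<lambda>w. Fr (X k w) - Fmin) \<and> (AE w in M. X k w \<in> dom_r)"
  using k
proof (induction k)
  case 0
  have "integrable M (\<lambda>w. Fr (X 0 w) - Fmin) \<longleftrightarrow> integrable M (\<lambda>w. Fr x0 - Fmin)"
    by (rule Bochner_Integration.integrable_cong) (auto simp: X_0)
  then show ?case using X_0 x0_dom by simp
next
  case (Suc k)
  then have k: "k < K" and IH: "integrable M (\<lambda>w. Fr (X k w) - Fmin)" "AE w in M. X k w \<in> dom_r"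
    by auto
  show ?case
    using step_expectation(1,2)[OF k IH bound \<alpha> small[OF k]] by blast
qed

lemma decay_Suc: "decseq t \<Longrightarrow> decay (Suc k) \<le> decay k"
  unfolding decay_def using t_pos t_rho rho_pos decseqD[of t k "Suc k"]
  by (intro frac_le) (auto simp: mult_right_mono less_imp_le)

lemma weighted_sum_bound:
  assumes bound: "\<And>x. lip2 x \<le> \<alpha> * (env x - Fmin) + \<beta>" and \<alpha>: "0 \<le> \<alpha>" and \<beta>: "0 \<le> \<beta>"
    and dec: "decseq t" and small: "\<alpha> / lam * (\<Sum>k<K. noise k) < 1"
  shows "k < K \<Longrightarrow> integrable M (\<lambda>w. bregman_sym \<omega> lam (prx (X k w)) (X k w))"
    and "(1 - lam * (\<tau> + \<rho>)) * (\<Sum>k<K. t k * e_sym k)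
      \<le> (env x0 - Fmin + decay 0 / lam * (Fr x0 - Fmin) + \<beta> / lam * (\<Sum>k<K. noise k))
        / (1 - \<alpha> / lam * (\<Sum>k<K. noise k))"
proof -
  have small': "\<alpha> / lam * noise k \<le> 1" if "k < K" for k
  proof -
    have "noise k \<le> (\<Sum>k<K. noise k)" using that noise_pos
      by (intro member_le_sum) (auto simp: less_imp_le)
    then have "\<alpha> / lam * noise k \<le> \<alpha> / lam * (\<Sum>k<K. noise k)"
      using \<alpha> lam_pos by (intro mult_left_mono) auto
    then show ?thesis using small by simp
  qed
  have R: "integrable M (\<lambda>w. Fr (X k w) - Fmin) \<and> (AE w in M. X k w \<in> dom_r)" if "k \<le> K" for k
    using bound \<alpha> small' that by (rule run_integrable)
  note int = integrable_moments[OF _ conjunct1[OF R] conjunct2[OF R] bound]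
  show "k < K \<Longrightarrow> integrable M (\<lambda>w. bregman_sym \<omega> lam (prx (X k w)) (X k w))"
    by (intro int) auto
  have kap: "0 \<le> 1 - lam * (\<tau> + \<rho>)"
    using lam_less tau_pos rho_pos by (simp add: field_simps)
  have X0: "(\<integral>w. h (X 0 w) \<partial>M) = h x0" for h :: "'a \<Rightarrow> real"
  proof -
    have "(\<integral>w. h (X 0 w) \<partial>M) = (\<integral>w. h x0 \<partial>M)"
      by (rule Bochner_Integration.integral_cong) (auto simp: X_0)
    then show ?thesis by (simp add: RM.prob_space)
  qed
  have 0: "e_env 0 = env x0 - Fmin" "e_gap 0 = Fr x0 - Fmin"
    unfolding e_env_def e_gap_def using X0[of "\<lambda>x. env x - Fmin"] X0[of "\<lambda>x. Fr x - Fmin"] by auto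
  have lip: "e_lip k \<le> \<alpha> * e_env k + \<beta>" if "k \<le> K" for k
  proof -
    have "e_lip k \<le> (\<integral>w. \<alpha> * (env (X k w) - Fmin) + \<beta> \<partial>M)"
      unfolding e_lip_def using that
      by (intro integral_mono Bochner_Integration.integrable_add Bochner_Integration.integrable_mult_right int bound
          RM.integrable_const)
    also have "\<dots> = (\<integral>w. \<alpha> * (env (X k w) - Fmin) \<partial>M) + (\<integral>w. \<beta> \<partial>M)"
      using that by (intro Bochner_Integration.integral_add Bochner_Integration.integrable_mult_right int RM.integrable_const)
    finally show ?thesis by (simp add: e_env_def RM.prob_space)
  qed
  have "(1 - lam * (\<tau> + \<rho>)) * (\<Sum>k<K. t k * e_sym k)
      \<le> (e_env 0 + decay 0 / lam * e_gap 0 + \<beta> / lam * (\<Sum>k<K. noise k))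
        / (1 - \<alpha> / lam * (\<Sum>k<K. noise k))"
  proof (rule descent_recursion[where l = e_lip])
    fix k assume k: "k < K"
    show "e_env (Suc k) + decay k / lam * e_gap (Suc k) + (1 - lam * (\<tau> + \<rho>)) * (t k * e_sym k)
      \<le> e_env k + decay k / lam * e_gap k + noise k / (2 * lam) * (e_lip k + e_lip (Suc k))"
      using k R[of k] by (intro step_expectation(3)[OF k _ _ bound \<alpha> small'[OF k]]) auto
    show "0 \<le> (1 - lam * (\<tau> + \<rho>)) * (t k * e_sym k)"
      using kap t_pos[of k] unfolding e_sym_def
      by (intro mult_nonneg_nonneg Bochner_Integration.integral_nonneg) (auto simp: bregman_sym_prx_nonneg less_imp_le)
  next
    fix k assume k: "k \<le> K"
    show "0 \<le> e_env k" unfolding e_env_def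
      by (intro Bochner_Integration.integral_nonneg) (simp add: Fmin_le_env)
    have "AE w in M. 0 \<le> Fr (X k w) - Fmin"
      using conjunct2[OF R[OF k]] by (auto simp: Fmin_le)
    then show "0 \<le> e_gap k" unfolding e_gap_def by (rule integral_nonneg_AE)
  qed (use lip decay_Suc[OF dec] decay_pos noise_pos lam_pos \<alpha> \<beta> small in \<open>auto simp: less_imp_le\<close>)
  then show "(1 - lam * (\<tau> + \<rho>)) * (\<Sum>k<K. t k * e_sym k)
      \<le> (env x0 - Fmin + decay 0 / lam * (Fr x0 - Fmin) + \<beta> / lam * (\<Sum>k<K. noise k))
        / (1 - \<alpha> / lam * (\<Sum>k<K. noise k))"
    unfolding 0 .
qed

section \<open>The random output index\<close>

lemma kb_measurable: "kb \<in> measurable M (count_space {..<K})"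
  using run by (simp add: model_based_run_def)

lemma kb_less: "w \<in> space M \<Longrightarrow> kb w < K"
  using measurable_space[OF kb_measurable] by auto

text \<open>The index is independent of the samples, whereas \<open>X k\<close> is a function of
  them only almost surely. Replacing it by \<open>iterate k\<close> gives a variable measurable for
  the sigma-algebra of the samples, and the expectation factorizes.\<close>

lemma integral_kb_indicator:
  fixes h :: "'a \<Rightarrow> real"
  assumes k: "k < K" and h: "h \<in> borel_measurable borel" and int: "integrable M (\<lambda>w. h (X k w))"
  shows "integrable M (\<lambda>w. h (X k w) * (if kb w = k then 1 else 0))"
    and "(\<integral>w. h (X k w) * (if kb w = k then 1 else 0) \<partial>M) = t k / (\<Sum>i<K. t i) * (\<integral>w. h (X k w) \<partial>M)"
proof -
  note h[measurable]
  let ?\<Xi> = "\<lambda>w. \<lambda>i\<in>{..<K}. \<xi> i w"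
  let ?V = "vimage_algebra (space M) ?\<Xi> (Pi\<^sub>M {..<K} (\<lambda>_. P))"
  let ?W = "vimage_algebra (space M) kb (count_space {..<K})"
  let ?I = "\<lambda>w. if kb w = k then 1 else 0 :: real"
  define Y where "Y w = h (iterate k (?\<Xi> w))" for w
  have \<Xi>: "?\<Xi> \<in> space M \<rightarrow> space (Pi\<^sub>M {..<K} (\<lambda>_. P))"
    using measurable_space[OF xi_measurable] by (auto simp: space_PiM)
  have ind: "RM.indep_set (sets ?V) (sets ?W)"
    using run by (simp add: model_based_run_def)
  have it: "(\<lambda>s. h (iterate k s)) \<in> borel_measurable (Pi\<^sub>M {..<K} (\<lambda>_. P))"
    using measurable_compose[OF iterate_measurable h] k by simp
  have YV: "Y \<in> borel_measurable ?V"
    unfolding Y_def by (rule measurable_compose[OF measurable_vimage_algebra1[OF \<Xi>] it])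
  have kbW: "kb \<in> measurable ?W (count_space {..<K})"
    using kb_less by (intro measurable_vimage_algebra1) auto
  then have IW: "?I \<in> borel_measurable ?W"
    by (rule measurable_compose[where g = "\<lambda>j. if j = k then 1 else 0"]) simp
  have VM: "sets ?V \<subseteq> sets M" "sets ?W \<subseteq> sets M"
    using RM.indep_setD_ev1[OF ind] RM.indep_setD_ev2[OF ind] by auto
  have YM: "Y \<in> borel_measurable M" and IM: "?I \<in> borel_measurable M"
    using measurable_mono[OF order_refl refl VM(1)] measurable_mono[OF order_refl refl VM(2)] YV IW
    by auto
  have "{f -` A \<inter> space M |A. A \<in> sets borel} \<subseteq> sets N"
    if "f \<in> borel_measurable N" "space N = space M" for f :: "'w \<Rightarrow> real" and N :: "'w measure"
    using measurable_sets[OF that(1)] that(2) by auto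
  then have sub: "sigma_sets (space M) {f -` A \<inter> space M |A. A \<in> sets borel} \<subseteq> sets N"
    if "f \<in> borel_measurable N" "space N = space M" for f :: "'w \<Rightarrow> real" and N :: "'w measure"
    using sets.sigma_sets_subset[of _ N] that by simp
  \<comment> \<open>The sigma-algebras generated by \<open>Y\<close> and the indicator lie inside
    those of the samples and of the index, so independence is inherited.\<close>
  have indYI: "RM.indep_var borel Y borel ?I"
    unfolding RM.indep_var_eq
    by (intro conjI YM IM RM.indep_set_mono[OF ind] sub YV IW) (simp_all add: space_vimage_algebra)
  have XY: "AE w in M. h (X k w) = Y w"
    using X_eq_iterate[of k] k unfolding Y_def
    by (auto simp: iterate_cong[of k "\<lambda>i. \<xi> i w" "?\<Xi> w" for w])
  have [measurable]: "X k \<in> borel_measurable M" using X_measurable k by simp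
  note YM[measurable] IM[measurable]
  have Yint: "integrable M Y"
    using int XY by (subst integrable_cong_AE[of Y _ "\<lambda>w. h (X k w)"]) auto
  have Iint: "integrable M ?I"
    by (rule RM.integrable_const_bound[of _ 1]) auto
  have ae: "AE w in M. h (X k w) * ?I w = Y w * ?I w" using XY by auto
  have YI: "integrable M (\<lambda>w. Y w * ?I w)"
    by (rule RM.indep_var_integrable[OF indYI Yint Iint])
  then show "integrable M (\<lambda>w. h (X k w) * ?I w)"
    using ae by (subst integrable_cong_AE[of _ _ "\<lambda>w. Y w * ?I w"]) auto
  have "(\<integral>w. h (X k w) * ?I w \<partial>M) = (\<integral>w. Y w * ?I w \<partial>M)"
    using ae by (intro integral_cong_AE) auto
  also have "\<dots> = (\<integral>w. Y w \<partial>M) * (\<integral>w. ?I w \<partial>M)"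
    by (rule RM.indep_var_lebesgue_integral[OF indYI Yint Iint])
  also have "(\<integral>w. Y w \<partial>M) = (\<integral>w. h (X k w) \<partial>M)"
    using XY by (intro integral_cong_AE) auto
  also have "(\<integral>w. ?I w \<partial>M) = (\<integral>w. indicator {w \<in> space M. kb w = k} w \<partial>M)"
    by (intro Bochner_Integration.integral_cong) auto
  also have "\<dots> = measure M {w \<in> space M. kb w = k}"
    by (simp add: Int_absorb2 subset_eq)
  also have "\<dots> = t k / (\<Sum>i<K. t i)"
    using run k by (simp add: model_based_run_def)
  finally show "(\<integral>w. h (X k w) * ?I w \<partial>M) = t k / (\<Sum>i<K. t i) * (\<integral>w. h (X k w) \<partial>M)"
    by simp
qed

lemma expectation_random_index:
  assumes int: "\<And>k. k < K \<Longrightarrow> integrable M (\<lambda>w. bregman_sym \<omega> lam (prx (X k w)) (X k w))"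
  shows "integrable M (\<lambda>w. bregman_sym \<omega> lam (prx (X (kb w) w)) (X (kb w) w))"
    and "(\<integral>w. bregman_sym \<omega> lam (prx (X (kb w) w)) (X (kb w) w) \<partial>M)
      = (\<Sum>k<K. t k * e_sym k) / (\<Sum>k<K. t k)"
proof -
  let ?h = "\<lambda>x. bregman_sym \<omega> lam (prx x) x"
  let ?I = "\<lambda>k w. if kb w = k then 1 else 0 :: real"
  have eq: "?h (X (kb w) w) = (\<Sum>k<K. ?h (X k w) * ?I k w)" if "w \<in> space M" for w
  proof -
    have "(\<Sum>k<K. ?h (X k w) * ?I k w) = (\<Sum>k<K. if k = kb w then ?h (X k w) else 0)"
      by (intro sum.cong) auto
    then show ?thesis using kb_less[OF that] by simp
  qed
  note I = integral_kb_indicator[OF _ bregman_sym_prx_measurable int]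
  have "integrable M (\<lambda>w. \<Sum>k<K. ?h (X k w) * ?I k w)"
    by (intro Bochner_Integration.integrable_sum I) auto
  then show "integrable M (\<lambda>w. ?h (X (kb w) w))"
    using eq by (simp cong: Bochner_Integration.integrable_cong)
  have "(\<integral>w. ?h (X (kb w) w) \<partial>M) = (\<integral>w. (\<Sum>k<K. ?h (X k w) * ?I k w) \<partial>M)"
    using eq by (intro Bochner_Integration.integral_cong) auto
  also have "\<dots> = (\<Sum>k<K. (\<integral>w. ?h (X k w) * ?I k w \<partial>M))"
    by (intro Bochner_Integration.integral_sum I) auto
  also have "\<dots> = (\<Sum>k<K. t k / (\<Sum>i<K. t i) * e_sym k)"
    using I by (intro sum.cong) (auto simp: e_sym_def)
  finally show "(\<integral>w. ?h (X (kb w) w) \<partial>M) = (\<Sum>k<K. t k * e_sym k) / (\<Sum>k<K. t k)"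
    by (simp add: sum_divide_distrib)
qed

lemma expectation_bound:
  assumes bound: "\<And>x. lip2 x \<le> \<alpha> * (env x - Fmin) + \<beta>" and \<alpha>: "0 \<le> \<alpha>" and \<beta>: "0 \<le> \<beta>"
    and dec: "decseq t" and small: "\<alpha> / lam * (\<Sum>k<K. noise k) < 1" and K: "1 \<le> K"
  shows "integrable M (\<lambda>w. bregman_sym \<omega> lam (prx (X (kb w) w)) (X (kb w) w))"
    and "(\<integral>w. bregman_sym \<omega> lam (prx (X (kb w) w)) (X (kb w) w) \<partial>M)
      \<le> (env x0 - Fmin + decay 0 / lam * (Fr x0 - Fmin) + \<beta> / lam * (\<Sum>k<K. noise k))
        / ((1 - lam * (\<tau> + \<rho>)) * (1 - \<alpha> / lam * (\<Sum>k<K. noise k)) * (\<Sum>k<K. t k))"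
proof -
  note W = weighted_sum_bound[OF bound \<alpha> \<beta> dec small]
  show "integrable M (\<lambda>w. bregman_sym \<omega> lam (prx (X (kb w) w)) (X (kb w) w))"
    using W(1) by (rule expectation_random_index)
  have E: "(\<integral>w. bregman_sym \<omega> lam (prx (X (kb w) w)) (X (kb w) w) \<partial>M)
      = (\<Sum>k<K. t k * e_sym k) / (\<Sum>k<K. t k)"
    using W(1) by (rule expectation_random_index)
  have kap: "0 < 1 - lam * (\<tau> + \<rho>)"
    using lam_less tau_pos rho_pos by (simp add: field_simps)
  have T: "0 < (\<Sum>k<K. t k)" using K t_pos by (intro sum_pos) (auto simp: lessThan_empty_iff)
  define N where "N = env x0 - Fmin + decay 0 / lam * (Fr x0 - Fmin) + \<beta> / lam * (\<Sum>k<K. noise k)"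
  define d where "d = 1 - \<alpha> / lam * (\<Sum>k<K. noise k)"
  have "(\<Sum>k<K. t k * e_sym k) \<le> N / d / (1 - lam * (\<tau> + \<rho>))"
    using W(2) unfolding N_def[symmetric] d_def[symmetric] pos_le_divide_eq[OF kap]
    by (simp only: mult.commute)
  then have "(\<Sum>k<K. t k * e_sym k) / (\<Sum>k<K. t k) \<le> N / d / (1 - lam * (\<tau> + \<rho>)) / (\<Sum>k<K. t k)"
    using T by (intro divide_right_mono) auto
  then show "(\<integral>w. bregman_sym \<omega> lam (prx (X (kb w) w)) (X (kb w) w) \<partial>M)
      \<le> (env x0 - Fmin + decay 0 / lam * (Fr x0 - Fmin) + \<beta> / lam * (\<Sum>k<K. noise k))
        / ((1 - lam * (\<tau> + \<rho>)) * (1 - \<alpha> / lam * (\<Sum>k<K. noise k)) * (\<Sum>k<K. t k))"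
    unfolding E N_def[symmetric] d_def[symmetric] by (simp add: mult_ac)
qed

end

section \<open>Constants for equal step sizes\<close>

text \<open>The bounds on \<open>c\<close> keep \<open>s * \<rho>\<close> and
  \<open>s * \<tau>\<close> at most 1/2, so every factor in the denominators is at least 1/2; as K
  s^2 = c^2, S is at most 4 c^2. With 1 / \<lambda> = 2 (\<tau> + \<rho>) this produces the
  constants 4 and 8, and 1 - \<lambda> (\<tau> + \<rho>) = 1/2 the leading 2.\<close>

lemma constant_step_bound:
  fixes c \<delta> eg g \<alpha> \<beta> \<tau> \<rho> :: real
  assumes K: "1 \<le> K" and lam: "lam = 1 / (2 * (\<tau> + \<rho>))" and t: "\<And>k. t k = c / sqrt (real K)"
    and c: "0 < c" "c \<le> min (1 / (2 * \<rho>)) (1 / (2 * \<tau>))" and \<tau>: "0 < \<tau>" and \<rho>: "0 < \<rho>"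
    and \<delta>: "max eg g \<le> \<delta>" and g: "0 \<le> g" and \<alpha>: "0 \<le> \<alpha>" and \<beta>: "0 \<le> \<beta>"
    and small: "8 * \<alpha> * (\<tau> + \<rho>) * c\<^sup>2 < 1"
    and S: "S = (\<Sum>k<K. (t k)\<^sup>2 / ((1 - t k * \<rho>) * (1 - t k * \<tau>)))"
  shows "\<alpha> / lam * S < 1"
    and "(eg + t 0 / (lam * (1 - t 0 * \<rho>)) * g + \<beta> / lam * S)
          / ((1 - lam * (\<tau> + \<rho>)) * (1 - \<alpha> / lam * S) * (\<Sum>k<K. t k))
      \<le> 2 / (c * sqrt (real K)) *
          ((\<delta> + 4 * (\<tau> + \<rho>) * c * \<delta> / sqrt (real K) + 8 * (\<tau> + \<rho>) * \<beta> * c\<^sup>2)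
            / (1 - 8 * \<alpha> * (\<tau> + \<rho>) * c\<^sup>2))"
proof -
  define s where "s = c / sqrt (real K)"
  have sqK: "1 \<le> sqrt (real K)" using K by simp
  then have s: "0 < s" "s \<le> c" using c by (auto simp: s_def divide_le_eq)
  have "c * \<rho> \<le> 1 / 2" "c * \<tau> \<le> 1 / 2" using c \<tau> \<rho> by (auto simp: field_simps)
  then have sr: "s * \<rho> \<le> 1 / 2" and st: "s * \<tau> \<le> 1 / 2"
    using mult_right_mono[OF s(2) less_imp_le[OF \<rho>]] mult_right_mono[OF s(2) less_imp_le[OF \<tau>]]
    by linarith+
  have prod: "1 / 4 \<le> (1 - s * \<rho>) * (1 - s * \<tau>)"
    using mult_mono[of "1/2" "1 - s * \<rho>" "1/2" "1 - s * \<tau>"] sr st by simp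
  have Ks: "real K * s\<^sup>2 = c\<^sup>2" using K by (simp add: s_def power_divide)
  have "S = real K * s\<^sup>2 / ((1 - s * \<rho>) * (1 - s * \<tau>))"
    unfolding S t s_def[symmetric] by simp
  then have S_eq: "S = c\<^sup>2 / ((1 - s * \<rho>) * (1 - s * \<tau>))" by (simp add: Ks)
  also have "\<dots> \<le> c\<^sup>2 / (1 / 4)" using prod by (intro divide_left_mono) auto
  finally have S_le: "S \<le> 4 * c\<^sup>2" by simp
  have S_nonneg: "0 \<le> S" using prod unfolding S_eq by (intro divide_nonneg_nonneg) auto
  have T: "(\<Sum>k<K. t k) = c * sqrt (real K)"
  proof -
    have "(\<Sum>k<K. t k) = c * (real K / sqrt (real K))" by (simp add: t)
    then show ?thesis by (simp only: real_div_sqrt of_nat_0_le_iff)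
  qed
  have half: "1 - lam * (\<tau> + \<rho>) = 1 / 2" using \<tau> \<rho> by (simp add: lam field_simps)
  have inv: "x / lam = 2 * (\<tau> + \<rho>) * x" for x by (simp add: lam)
  have aS: "\<alpha> / lam * S \<le> 8 * \<alpha> * (\<tau> + \<rho>) * c\<^sup>2"
  proof -
    have "2 * (\<tau> + \<rho>) * \<alpha> * S \<le> 2 * (\<tau> + \<rho>) * \<alpha> * (4 * c\<^sup>2)"
      using \<tau> \<rho> \<alpha> by (intro mult_left_mono[OF S_le]) simp
    also have "\<dots> = 8 * \<alpha> * (\<tau> + \<rho>) * c\<^sup>2" by (simp add: algebra_simps)
    finally show ?thesis by (simp only: inv)
  qed
  then show "\<alpha> / lam * S < 1" using small by simp
  have bS: "\<beta> / lam * S \<le> 8 * (\<tau> + \<rho>) * \<beta> * c\<^sup>2"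
  proof -
    have "2 * (\<tau> + \<rho>) * \<beta> * S \<le> 2 * (\<tau> + \<rho>) * \<beta> * (4 * c\<^sup>2)"
      using \<tau> \<rho> \<beta> by (intro mult_left_mono[OF S_le]) simp
    also have "\<dots> = 8 * (\<tau> + \<rho>) * \<beta> * c\<^sup>2" by (simp add: algebra_simps)
    finally show ?thesis by (simp only: inv)
  qed
  have \<delta>0: "0 \<le> \<delta>" "eg \<le> \<delta>" "g \<le> \<delta>" using \<delta> g by auto
  have "s / (1 - s * \<rho>) \<le> s / (1 / 2)" using s sr by (intro divide_left_mono) auto
  moreover have "0 \<le> s / (1 - s * \<rho>)" using s sr by (intro divide_nonneg_nonneg) auto
  ultimately have "2 * (\<tau> + \<rho>) * (s / (1 - s * \<rho>)) * g \<le> 2 * (\<tau> + \<rho>) * (2 * s) * \<delta>"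
    using \<delta>0 g \<tau> \<rho> s by (intro mult_mono) auto
  moreover have "t 0 / (lam * (1 - t 0 * \<rho>)) = 2 * (\<tau> + \<rho>) * (s / (1 - s * \<rho>))"
    unfolding t s_def[symmetric] divide_divide_eq_left[symmetric] inv by simp
  moreover have "2 * (\<tau> + \<rho>) * (2 * s) * \<delta> = 4 * (\<tau> + \<rho>) * c * \<delta> / sqrt (real K)"
    by (simp add: s_def)
  ultimately have "t 0 / (lam * (1 - t 0 * \<rho>)) * g \<le> 4 * (\<tau> + \<rho>) * c * \<delta> / sqrt (real K)"
    by (simp only:)
  then have num: "eg + t 0 / (lam * (1 - t 0 * \<rho>)) * g + \<beta> / lam * S
      \<le> \<delta> + 4 * (\<tau> + \<rho>) * c * \<delta> / sqrt (real K) + 8 * (\<tau> + \<rho>) * \<beta> * c\<^sup>2" (is "?N \<le> ?N'")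
    using bS \<delta>0 by (intro add_mono)
  have "0 \<le> ?N'" using \<delta>0 \<tau> \<rho> \<beta> c by simp
  then have frac: "?N / (1 - \<alpha> / lam * S) \<le> ?N' / (1 - 8 * \<alpha> * (\<tau> + \<rho>) * c\<^sup>2)"
    using num aS small by (intro frac_le) auto
  have "?N / ((1 - lam * (\<tau> + \<rho>)) * (1 - \<alpha> / lam * S) * (\<Sum>k<K. t k))
      = 2 / (c * sqrt (real K)) * (?N / (1 - \<alpha> / lam * S))"
    unfolding half T by (simp add: mult_ac)
  also have "\<dots> \<le> 2 / (c * sqrt (real K)) * (?N' / (1 - 8 * \<alpha> * (\<tau> + \<rho>) * c\<^sup>2))"
    using frac c by (intro mult_left_mono) auto
  finally show "?N / ((1 - lam * (\<tau> + \<rho>)) * (1 - \<alpha> / lam * S) * (\<Sum>k<K. t k))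
      \<le> 2 / (c * sqrt (real K)) * (?N' / (1 - 8 * \<alpha> * (\<tau> + \<rho>) * c\<^sup>2))" .
qed

theorem theorem3p1:
  fixes P :: "'o measure" and M :: "'w measure"
    and fs :: "real ^ 'n \<Rightarrow> 'o \<Rightarrow> real"
    and r :: "real ^ 'n \<Rightarrow> ereal"
    and fm :: "real ^ 'n \<Rightarrow> real ^ 'n \<Rightarrow> 'o \<Rightarrow> real"
    and \<omega> :: "real ^ 'n \<Rightarrow> real"
    and \<tau> \<rho> lam :: real
    and Lt :: "real ^ 'n \<Rightarrow> 'o \<Rightarrow> real"
    and L :: "real ^ 'n \<Rightarrow> real"
    and K :: nat and t :: "nat \<Rightarrow> real"
    and x0 :: "real ^ 'n"
    and \<xi> :: "nat \<Rightarrow> 'w \<Rightarrow> 'o"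
    and X :: "nat \<Rightarrow> 'w \<Rightarrow> real ^ 'n"
    and kb :: "'w \<Rightarrow> nat"
    and F :: "real ^ 'n \<Rightarrow> ereal"
    and Fstar :: real
    and Fenv :: "real ^ 'n \<Rightarrow> real"
    and gap0 env_gap0 S :: real
    and Z :: "'w \<Rightarrow> real"
  assumes model: "stochastic_model P fs r fm \<omega> \<tau> \<rho> Lt L"
    and K: "1 \<le> K"
    and lam_range: "0 < lam" "lam < 1 / (\<tau> + \<rho>)"
    and t_noninc: "decseq t"
    and t_bounds: "\<And>k. 0 < t k" "\<And>k. t k < min (1 / \<rho>) (1 / \<tau>)"
    and x0: "r x0 < \<infinity>"
    and run: "model_based_run M P fm r \<omega> t K x0 \<xi> X kb"
    and F: "F = objective P fs r"
    and Fstar: "Fstar = real_of_ereal (INF x. F x)"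
    and Fenv: "Fenv = (\<lambda>x. real_of_ereal (moreau_env \<omega> lam F x))"
    and gap0: "gap0 = real_of_ereal (F x0) - Fstar"
    and env_gap0: "env_gap0 = Fenv x0 - Fstar"
    and S: "S = (\<Sum>k<K. (t k)\<^sup>2 / ((1 - t k * \<rho>) * (1 - t k * \<tau>)))"
    and Z: "Z = (\<lambda>w. bregman_sym \<omega> lam (prox \<omega> lam F (X (kb w) w)) (X (kb w) w))"
  shows
    "(\<forall>Lf>0. (\<forall>x. L x \<le> Lf) \<longrightarrow>
        integrable M Z \<and>
        (\<integral>w. Z w \<partial>M) \<le>
          (env_gap0 + t 0 / (lam * (1 - t 0 * \<rho>)) * gap0 + Lf\<^sup>2 / lam * S)
            / ((1 - lam * (\<tau> + \<rho>)) * (\<Sum>k<K. t k)) \<and>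
        (\<forall>c \<delta>. lam = 1 / (2 * (\<tau> + \<rho>)) \<and> (\<forall>k. t k = c / sqrt (real K)) \<and>
            0 < c \<and> c \<le> min (1 / (2 * \<rho>)) (1 / (2 * \<tau>)) \<and> max env_gap0 gap0 \<le> \<delta> \<longrightarrow>
          (\<integral>w. Z w \<partial>M) \<le>
            2 / (c * sqrt (real K)) *
              (\<delta> + 4 * (\<tau> + \<rho>) * c * \<delta> / sqrt (real K) + 8 * (\<tau> + \<rho>) * Lf\<^sup>2 * c\<^sup>2)))
     \<and>
     (\<forall>\<alpha>>0. \<forall>\<beta>>0. (\<forall>x. L x \<le> sqrt (\<alpha> * (Fenv x - Fstar) + \<beta>)) \<longrightarrow>
        (\<alpha> / lam * S < 1 \<longrightarrow>
          integrable M Z \<and>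
          (\<integral>w. Z w \<partial>M) \<le>
            (env_gap0 + t 0 / (lam * (1 - t 0 * \<rho>)) * gap0 + \<beta> / lam * S)
              / ((1 - lam * (\<tau> + \<rho>)) * (1 - \<alpha> / lam * S) * (\<Sum>k<K. t k))) \<and>
        (\<forall>c \<delta>. lam = 1 / (2 * (\<tau> + \<rho>)) \<and> (\<forall>k. t k = c / sqrt (real K)) \<and>
            0 < c \<and> c \<le> min (1 / (2 * \<rho>)) (1 / (2 * \<tau>)) \<and>
            8 * \<alpha> * (\<tau> + \<rho>) * c\<^sup>2 < 1 \<and> max env_gap0 gap0 \<le> \<delta> \<longrightarrow>
          integrable M Z \<and>
          (\<integral>w. Z w \<partial>M) \<le>
            2 / (c * sqrt (real K)) *
              ((\<delta> + 4 * (\<tau> + \<rho>) * c * \<delta> / sqrt (real K) + 8 * (\<tau> + \<rho>) * \<beta> * c\<^sup>2)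
                / (1 - 8 * \<alpha> * (\<tau> + \<rho>) * c\<^sup>2))))"
proof -
  interpret prox_model P fs r fm \<omega> \<tau> \<rho> Lt L lam
    using model lam_range by (simp add: prox_model_def prox_model_axioms_def)
  have tr: "t k * \<rho> < 1" "t k * \<tau> < 1" for k
    using t_bounds(2)[of k] tau_pos rho_pos by (auto simp: field_simps)
  have x0_dom: "x0 \<in> dom_r" using x0 by (simp add: dom_r_def)
  interpret model_run P fs r fm \<omega> \<tau> \<rho> Lt L lam M t K x0 \<xi> X kb
    using run t_bounds(1) tr x0_dom by unfold_locales
  have Fstar': "Fstar = Fmin" by (simp add: Fstar F Fmin_def)
  have Fenv': "Fenv = env" by (simp add: Fenv F env_def fun_eq_iff)
  have gap0': "gap0 = Fr x0 - Fmin" by (simp add: gap0 Fstar' F objective_eq[OF x0_dom])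
  have env_gap0': "env_gap0 = env x0 - Fmin" by (simp add: env_gap0 Fstar' Fenv')
  have S': "S = (\<Sum>k<K. noise k)" by (simp add: S noise_def)
  have Z': "Z = (\<lambda>w. bregman_sym \<omega> lam (prx (X (kb w) w)) (X (kb w) w))"
    by (simp add: Z F prx_def)
  have gap0_nonneg: "0 \<le> gap0" using Fmin_le[OF x0_dom] by (simp add: gap0')
  have main: "integrable M Z \<and> (\<integral>w. Z w \<partial>M) \<le>
          (env_gap0 + t 0 / (lam * (1 - t 0 * \<rho>)) * gap0 + \<beta> / lam * S)
            / ((1 - lam * (\<tau> + \<rho>)) * (1 - \<alpha> / lam * S) * (\<Sum>k<K. t k))"
    if "\<And>x. (L x)\<^sup>2 \<le> \<alpha> * (Fenv x - Fstar) + \<beta>" "0 \<le> \<alpha>" "0 \<le> \<beta>" "\<alpha> / lam * S < 1" for \<alpha> \<beta>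
  proof -
    have "lip2 x \<le> \<alpha> * (env x - Fmin) + \<beta>" for x
      using lip2_le[of x] that(1)[of x] by (simp add: Fenv' Fstar')
    note E = expectation_bound[OF this that(2,3) t_noninc that(4)[unfolded S'] K]
    have "decay 0 / lam = t 0 / (lam * (1 - t 0 * \<rho>))" by (simp add: decay_def mult.commute)
    then show ?thesis using E unfolding Z' S' gap0' env_gap0' by simp
  qed
  have special: "\<alpha> / lam * S < 1 \<and> (env_gap0 + t 0 / (lam * (1 - t 0 * \<rho>)) * gap0 + \<beta> / lam * S)
          / ((1 - lam * (\<tau> + \<rho>)) * (1 - \<alpha> / lam * S) * (\<Sum>k<K. t k))
      \<le> 2 / (c * sqrt (real K)) *
          ((\<delta> + 4 * (\<tau> + \<rho>) * c * \<delta> / sqrt (real K) + 8 * (\<tau> + \<rho>) * \<beta> * c\<^sup>2)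
            / (1 - 8 * \<alpha> * (\<tau> + \<rho>) * c\<^sup>2))"
    if "lam = 1 / (2 * (\<tau> + \<rho>)) \<and> (\<forall>k. t k = c / sqrt (real K)) \<and>
            0 < c \<and> c \<le> min (1 / (2 * \<rho>)) (1 / (2 * \<tau>)) \<and> max env_gap0 gap0 \<le> \<delta>"
      "8 * \<alpha> * (\<tau> + \<rho>) * c\<^sup>2 < 1" "0 \<le> \<alpha>" "0 \<le> \<beta>" for \<alpha> \<beta> c \<delta>
    using constant_step_bound[where c = c and eg = env_gap0 and \<delta> = \<delta>,
        OF K _ _ _ _ tau_pos rho_pos _ gap0_nonneg that(3,4,2) S] that(1)
    by blast
  show ?thesis
  proof (intro conjI allI impI)
    fix Lf :: real assume Lf: "0 < Lf" "\<forall>x. L x \<le> Lf"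
    have L2: "(L x)\<^sup>2 \<le> 0 * (Fenv x - Fstar) + Lf\<^sup>2" for x
      using Lf L_nonneg[of x] by (simp add: power_mono)
    have A: "integrable M Z \<and> (\<integral>w. Z w \<partial>M) \<le>
          (env_gap0 + t 0 / (lam * (1 - t 0 * \<rho>)) * gap0 + Lf\<^sup>2 / lam * S)
            / ((1 - lam * (\<tau> + \<rho>)) * (\<Sum>k<K. t k))"
      using main[OF L2] by simp
    then show "integrable M Z" and "(\<integral>w. Z w \<partial>M) \<le>
          (env_gap0 + t 0 / (lam * (1 - t 0 * \<rho>)) * gap0 + Lf\<^sup>2 / lam * S)
            / ((1 - lam * (\<tau> + \<rho>)) * (\<Sum>k<K. t k))" by auto
    fix c \<delta>
    assume "lam = 1 / (2 * (\<tau> + \<rho>)) \<and> (\<forall>k. t k = c / sqrt (real K)) \<and>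
            0 < c \<and> c \<le> min (1 / (2 * \<rho>)) (1 / (2 * \<tau>)) \<and> max env_gap0 gap0 \<le> \<delta>"
    \<comment> \<open>With \<alpha> = 0 both factors that contain \<alpha> are 1 and the smallness
      condition is trivial.\<close>
    from special[OF this, of 0 "Lf\<^sup>2"] A
    show "(\<integral>w. Z w \<partial>M) \<le> 2 / (c * sqrt (real K)) *
              (\<delta> + 4 * (\<tau> + \<rho>) * c * \<delta> / sqrt (real K) + 8 * (\<tau> + \<rho>) * Lf\<^sup>2 * c\<^sup>2)"
      by simp
  next
    fix \<alpha> \<beta> :: real
    assume ab: "0 < \<alpha>" "0 < \<beta>" and L: "\<forall>x. L x \<le> sqrt (\<alpha> * (Fenv x - Fstar) + \<beta>)"
    have L2: "(L x)\<^sup>2 \<le> \<alpha> * (Fenv x - Fstar) + \<beta>" for x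
    proof -
      \<comment> \<open>The envelope never falls below the infimum, so the radicand is nonnegative
        and squaring undoes the square root.\<close>
      have "0 \<le> \<alpha> * (Fenv x - Fstar) + \<beta>"
        using ab Fmin_le_env[of x] by (simp add: Fenv' Fstar')
      moreover have "(L x)\<^sup>2 \<le> (sqrt (\<alpha> * (Fenv x - Fstar) + \<beta>))\<^sup>2"
        using L L_nonneg[of x] by (intro power_mono) auto
      ultimately show ?thesis by simp
    qed
    note B = main[OF L2 less_imp_le[OF ab(1)] less_imp_le[OF ab(2)]]
    show "integrable M Z" and "(\<integral>w. Z w \<partial>M) \<le>
            (env_gap0 + t 0 / (lam * (1 - t 0 * \<rho>)) * gap0 + \<beta> / lam * S)
              / ((1 - lam * (\<tau> + \<rho>)) * (1 - \<alpha> / lam * S) * (\<Sum>k<K. t k))"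
      if "\<alpha> / lam * S < 1"
      using B[OF that] by auto
    fix c \<delta>
    assume "lam = 1 / (2 * (\<tau> + \<rho>)) \<and> (\<forall>k. t k = c / sqrt (real K)) \<and>
            0 < c \<and> c \<le> min (1 / (2 * \<rho>)) (1 / (2 * \<tau>)) \<and>
            8 * \<alpha> * (\<tau> + \<rho>) * c\<^sup>2 < 1 \<and> max env_gap0 gap0 \<le> \<delta>"
    \<comment> \<open>The condition on 8 \<alpha> (\<tau> + \<rho>) c^2 implies the general
      smallness condition because S is at most 4 c^2.\<close>
    then have "\<alpha> / lam * S < 1 \<and> (env_gap0 + t 0 / (lam * (1 - t 0 * \<rho>)) * gap0 + \<beta> / lam * S)
          / ((1 - lam * (\<tau> + \<rho>)) * (1 - \<alpha> / lam * S) * (\<Sum>k<K. t k))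
      \<le> 2 / (c * sqrt (real K)) *
          ((\<delta> + 4 * (\<tau> + \<rho>) * c * \<delta> / sqrt (real K) + 8 * (\<tau> + \<rho>) * \<beta> * c\<^sup>2)
            / (1 - 8 * \<alpha> * (\<tau> + \<rho>) * c\<^sup>2))"
      using ab by (intro special) auto
    then show "integrable M Z" and "(\<integral>w. Z w \<partial>M) \<le>
            2 / (c * sqrt (real K)) *
              ((\<delta> + 4 * (\<tau> + \<rho>) * c * \<delta> / sqrt (real K) + 8 * (\<tau> + \<rho>) * \<beta> * c\<^sup>2)
                / (1 - 8 * \<alpha> * (\<tau> + \<rho>) * c\<^sup>2))"
      using B by (auto intro: order_trans)
  qed
qed

end
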